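(* Let $R$ (red points) and $B$ (blue points) be independent Poisson point processes of intensity $1$ on $\mathbb{R}$. Almost surely, the $(\gamma,\infty)$-minimal matchings between $R$ and $B$ are as follows. (i) For $\gamma\in(-\infty,0)$, there exist uncountably many $(\gamma,\infty)$-minimal matchings. (ii) For $\gamma\in[0,1)\cup\{1^-\}$, where the cost of any blue-red edge is infinite and hence one minimizes over matchings with only red-blue edges, there exists a unique $(\gamma,\infty)$-minimal matching. (iii) For $\gamma=1$, similarly minimizing over matchings with only red-blue edges, there are uncountably many $(1,\infty)$-minimal matchings. (iv) For $\gamma\in\{1^+\}\cup(1,\infty)$, there does not exist a $(\gamma,\infty)$-minimal matching consisting only of red-blue edges.
   Context: A matching $M$ between $R$ (red) and $B$ (blue) is a set of edges $\langle x,y\rangle$, $x\in R$, $y\in B$, with each point in at most one edge. An edge $\langle x,y\rangle$ is a red-blue edge if $x<y$ and a blue-red edge if $y<x$. The edge $\langle x,y\rangle$ costs $f(y-x)$, and the cost of a finite matching is the sum over its edges; unmatched points count as infinite cost. Call a finite set $S\subset R\cup B$ admissible for $M$ if it is a union of edges of $M$ and unmatched points, and write $M|_S$ for the restriction of $M$ to $S$. Case $\gamma<0$, $a=\infty$: the cost function is $f_{\gamma,\infty}(x)=-\infty$ for $x<0$ and $f_{\gamma,\infty}(x)=-x^{\gamma}$ for $x>0$ (a sum containing a term $-\infty$ equals $-\infty$). $M$ is $(\gamma,\infty)$-minimal if for every admissible $S$, $M|_S$ has minimal cost among all matchings between $R\cap S$ and $B\cap S$ with as few unmatched points as possible. Case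 $\gamma\ge0$, $a=\infty$: every blue-red edge has infinite cost, and a red-blue edge of length $\ell$ has cost $\ell^\gamma$ if $\gamma>0$ and $\log\ell$ if $\gamma=0$. Only matchings consisting entirely of red-blue edges are considered: such a matching $M$ is $(\gamma,\infty)$-minimal if for every admissible $S$, $M|_S$ has minimal cost among those matchings between $R\cap S$ and $B\cap S$ which consist only of red-blue edges and have as few unmatched points as possible subject to this. $M$ is $(1^+,\infty)$-minimal (resp. $(1^-,\infty)$-minimal) if for every admissible $S$, $M|_S$ has this minimality property for all $\gamma>1$ (resp. $\gamma<1$) sufficiently close to $1$. *)

theory Defs
  imports "HOL-Probability.Probability"
begin

section \<open>Poisson point processes on the line\<close>

text \<open>
  A Poisson point process on the line is almost surely simple, so a realization is represented
  by its set of points, a locally finite subset of the line.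
\<close>

definition configurations :: "real set set" where
  "configurations = {X. \<forall>K. bounded K \<longrightarrow> finite (X \<inter> K)}"

text \<open>The usual sigma-algebra on configurations, generated by the counts in bounded Borel sets.\<close>

definition configuration_space :: "real set measure" where
  "configuration_space = sigma configurations
     {{X \<in> configurations. card (X \<inter> A) = k} | A k. A \<in> sets borel \<and> bounded A}"

definition poisson_point_process :: "'w measure \<Rightarrow> real \<Rightarrow> ('w \<Rightarrow> real set) \<Rightarrow> bool" where
  "poisson_point_process P \<rho> X \<longleftrightarrow>
     X \<in> measurable P configuration_space \<and>
     (\<forall>A \<in> sets borel. bounded A \<longrightarrow>
        (\<forall>k. measure P {\<omega> \<in> space P. card (X \<omega> \<inter> A) = k} =
             exp (- (\<rho> * measure lborel A)) * (\<rho> * measure lborel A) ^ k / fact k)) \<and>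
     (\<forall>\<A> \<subseteq> {A \<in> sets borel. bounded A}. finite \<A> \<and> disjoint \<A> \<longrightarrow>
        prob_space.indep_vars P (\<lambda>_. count_space UNIV) (\<lambda>A \<omega>. card (X \<omega> \<inter> A)) \<A>)"

section \<open>Matchings\<close>

text \<open>An edge is a pair whose first component is its red and second component its blue endpoint.\<close>

type_synonym edge = "real \<times> real"

definition endpoints :: "edge \<Rightarrow> real set" where
  "endpoints e = {fst e, snd e}"

definition matching :: "real set \<Rightarrow> real set \<Rightarrow> edge set \<Rightarrow> bool" where
  "matching R B M \<longleftrightarrow> M \<subseteq> R \<times> B \<and> disjoint_family_on endpoints M"

definition red_blue_matching :: "real set \<Rightarrow> real set \<Rightarrow> edge set \<Rightarrow> bool" where
  "red_blue_matching R B M \<longleftrightarrow> matching R B M \<and> (\<forall>(x, y) \<in> M. x < y)"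

definition unmatched :: "real set \<Rightarrow> real set \<Rightarrow> edge set \<Rightarrow> real set" where
  "unmatched R B M = (R \<union> B) - (\<Union>e \<in> M. endpoints e)"

definition admissible :: "real set \<Rightarrow> real set \<Rightarrow> edge set \<Rightarrow> real set \<Rightarrow> bool" where
  "admissible R B M S \<longleftrightarrow> finite S \<and>
     (\<exists>E U. E \<subseteq> M \<and> U \<subseteq> unmatched R B M \<and> S = (\<Union>e \<in> E. endpoints e) \<union> U)"

definition restrict_matching :: "edge set \<Rightarrow> real set \<Rightarrow> edge set" where
  "restrict_matching M S = {e \<in> M. endpoints e \<subseteq> S}"

section \<open>Costs and minimality\<close>

text \<open>
  The value at signed length \<open>x = 0\<close> is a convention without effect: almost surely no point is
  both red and blue, and red-blue edges have positive length.
\<close>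

definition edge_cost :: "real \<Rightarrow> real \<Rightarrow> ereal" where
  "edge_cost \<gamma> x =
     (if \<gamma> < 0 then (if x > 0 then ereal (- (x powr \<gamma>)) else - \<infinity>)
      else if x > 0 then ereal (if \<gamma> = 0 then ln x else x powr \<gamma>) else \<infinity>)"

text \<open>
  In \<^typ>\<open>ereal\<close>, a finite sum with a term \<open>- \<infinity>\<close> and no term \<open>\<infinity>\<close> is \<open>- \<infinity>\<close>. For a fixed
  exponent the two infinite values never occur together.
\<close>

definition cost :: "real \<Rightarrow> edge set \<Rightarrow> ereal" where
  "cost \<gamma> M = (\<Sum>(x, y) \<in> M. edge_cost \<gamma> (y - x))"

text \<open>The matchings that compete for the exponent \<open>\<gamma>\<close>.\<close>

definition feasible :: "real \<Rightarrow> real set \<Rightarrow> real set \<Rightarrow> edge set \<Rightarrow> bool" where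
  "feasible \<gamma> R B M \<longleftrightarrow> (if \<gamma> < 0 then matching R B M else red_blue_matching R B M)"

definition optimal :: "real \<Rightarrow> real set \<Rightarrow> real set \<Rightarrow> edge set \<Rightarrow> bool" where
  "optimal \<gamma> R B M \<longleftrightarrow>
     is_arg_min (cost \<gamma>) (is_arg_min (\<lambda>M'. card (unmatched R B M')) (feasible \<gamma> R B)) M"

definition minimal_matching :: "real \<Rightarrow> real set \<Rightarrow> real set \<Rightarrow> edge set \<Rightarrow> bool" where
  "minimal_matching \<gamma> R B M \<longleftrightarrow> feasible \<gamma> R B M \<and>
     (\<forall>S. admissible R B M S \<longrightarrow> optimal \<gamma> (R \<inter> S) (B \<inter> S) (restrict_matching M S))"

text \<open>
  Minimality for \<open>1\<^sup>+\<close> and \<open>1\<^sup>-\<close>. How close to 1 the exponent has to be may depend on \<open>S\<close>.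
\<close>

definition minimal_matching_1plus :: "real set \<Rightarrow> real set \<Rightarrow> edge set \<Rightarrow> bool" where
  "minimal_matching_1plus R B M \<longleftrightarrow> red_blue_matching R B M \<and>
     (\<forall>S. admissible R B M S \<longrightarrow>
        (\<forall>\<^sub>F \<gamma> in at_right 1. optimal \<gamma> (R \<inter> S) (B \<inter> S) (restrict_matching M S)))"

definition minimal_matching_1minus :: "real set \<Rightarrow> real set \<Rightarrow> edge set \<Rightarrow> bool" where
  "minimal_matching_1minus R B M \<longleftrightarrow> red_blue_matching R B M \<and>
     (\<forall>S. admissible R B M S \<longrightarrow>
        (\<forall>\<^sub>F \<gamma> in at_left 1. optimal \<gamma> (R \<inter> S) (B \<inter> S) (restrict_matching M S)))"

end

(*
  Only the following properties of a realization matter: the points are locally finite, no point is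
  red and blue, and the walk that steps up at red and down at blue points is unbounded above and
  below in both directions. Almost sure unboundedness comes from blocks of rapidly growing length, in
  which the excess of one colour beats everything that happened before with probability bounded
  below.

  For exponents at least 0 the edge cost is increasing, so an unmatched point is covered by no edge
  of a minimal matching; all later (or earlier) points of the other colour would then be matched
  beyond it, which bounds the walk on one side. So minimal matchings are perfect. Strict concavity
  excludes crossing edges, and the only noncrossing perfect matching pairs an up-step of the walk
  with the next down-step through the same level. Strict convexity excludes nested edges, and then
  the partners of all blue points to the right of one edge lie to the right of its red end, which
  again bounds the walk. For exponent 1 all perfect red-blue matchings have the same cost, and for
  negative exponents every perfect matching by blue-red edges has cost minus infinity on each
  nonempty test set. There are uncountably many such matchings, since infinitely many disjoint pairs
  of edges can exchange their blue (respectively red) ends independently.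
*)
theory Submission imports Defs begin

section \<open>Matchings between disjoint sets\<close>

text \<open>Two edges can meet only red on red or blue on blue, so disjointness of the edges splits
  into injectivity of the two projections.\<close>

lemma matching_iff:
  assumes "R \<inter> B = {}"
  shows "matching R B M \<longleftrightarrow> M \<subseteq> R \<times> B \<and> inj_on fst M \<and> inj_on snd M"
proof -
  have "disjoint_family_on endpoints M \<longleftrightarrow> inj_on fst M \<and> inj_on snd M" if M: "M \<subseteq> R \<times> B"
  proof
    assume "disjoint_family_on endpoints M"
    then show "inj_on fst M \<and> inj_on snd M"
      by (fastforce simp: disjoint_family_on_def endpoints_def inj_on_def)
  next
    assume inj: "inj_on fst M \<and> inj_on snd M"
    show "disjoint_family_on endpoints M"
      unfolding disjoint_family_on_def
    proof (intro ballI impI)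
      fix e e' assume e: "e \<in> M" "e' \<in> M" "e \<noteq> e'"
      have "fst e \<noteq> fst e'" "snd e \<noteq> snd e'" using inj e by (auto dest: inj_onD)
      moreover have "fst e \<noteq> snd e'" "snd e \<noteq> fst e'" using e M assms by (auto, force+)
      ultimately show "endpoints e \<inter> endpoints e' = {}" by (auto simp: endpoints_def)
    qed
  qed
  then show ?thesis unfolding matching_def by blast
qed

lemma unmatched_eq:
  assumes "R \<inter> B = {}" "M \<subseteq> R \<times> B"
  shows "unmatched R B M = (R - fst ` M) \<union> (B - snd ` M)"
  using assms unfolding unmatched_def endpoints_def by fastforce

lemma red_blue_matching_iff:
  assumes "R \<inter> B = {}"
  shows "red_blue_matching R B M \<longleftrightarrow>
    M \<subseteq> R \<times> B \<and> inj_on fst M \<and> inj_on snd M \<and> (\<forall>x y. (x, y) \<in> M \<longrightarrow> x < y)"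
  unfolding red_blue_matching_def matching_iff[OF assms] by auto

definition perfect :: "real set \<Rightarrow> real set \<Rightarrow> edge set \<Rightarrow> bool" where
  "perfect R B M \<longleftrightarrow> red_blue_matching R B M \<and> unmatched R B M = {}"

lemma perfect_iff:
  assumes "R \<inter> B = {}"
  shows "perfect R B M \<longleftrightarrow>
    fst ` M = R \<and> snd ` M = B \<and> inj_on fst M \<and> inj_on snd M \<and> (\<forall>x y. (x, y) \<in> M \<longrightarrow> x < y)"
proof
  assume "perfect R B M"
  then show "fst ` M = R \<and> snd ` M = B \<and> inj_on fst M \<and> inj_on snd M \<and> (\<forall>x y. (x, y) \<in> M \<longrightarrow> x < y)"
    unfolding perfect_def red_blue_matching_iff[OF assms] using unmatched_eq[OF assms, of M] by auto
next
  assume r: "fst ` M = R \<and> snd ` M = B \<and> inj_on fst M \<and> inj_on snd M \<and> (\<forall>x y. (x, y) \<in> M \<longrightarrow> x < y)"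
  then have "M \<subseteq> R \<times> B" by force
  then show "perfect R B M"
    unfolding perfect_def red_blue_matching_iff[OF assms] using r unmatched_eq[OF assms, of M] by auto
qed

section \<open>Crossing, nesting and the uniqueness of noncrossing perfect matchings\<close>

definition noncrossing :: "edge set \<Rightarrow> bool" where
  "noncrossing M \<longleftrightarrow>
    (\<forall>x y x' y'. (x, y) \<in> M \<longrightarrow> (x', y') \<in> M \<longrightarrow> x < x' \<longrightarrow> x' < y \<longrightarrow> y' \<le> y)"

text \<open>For red-blue edges the only violation is \<open>x < x' < y' < y\<close>, so the matching
  preserves order. In the same way \<open>noncrossing\<close> excludes
  \<open>x < x' < y < y'\<close>.\<close>

definition nonnesting :: "edge set \<Rightarrow> bool" where
  "nonnesting M \<longleftrightarrow> (\<forall>x y x' y'. (x, y) \<in> M \<longrightarrow> (x', y') \<in> M \<longrightarrow> x < x' \<longrightarrow> y \<le> y')"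

lemma finite_configuration:
  assumes "X \<in> configurations"
  shows "finite (X \<inter> {s<..t})" "finite (X \<inter> {s<..<t})" "finite (X \<inter> {s..<t})" "finite (X \<inter> {s..t})"
  using assms unfolding configurations_def by auto

text \<open>If \<open>y < y'\<close>, count the points between \<open>x\<close> and
  \<open>y\<close>. Edges of \<open>M\<close> that start there end there, so there are at most as
  many reds as blues, and \<open>y\<close> is one blue more. But \<open>M'\<close> has to supply all
  these blues from reds strictly between \<open>x\<close> and \<open>y\<close>.\<close>

lemma noncrossing_partner_le:
  assumes disj: "R \<inter> B = {}" and fin: "R \<in> configurations" "B \<in> configurations"
    and M: "perfect R B M" "noncrossing M" and M': "perfect R B M'" "noncrossing M'"
    and e: "(x, y) \<in> M" "(x, y') \<in> M'"
  shows "y' \<le> y"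
proof (rule ccontr)
  assume "\<not> y' \<le> y"
  then have yy: "y < y'" by simp
  note m = M(1)[unfolded perfect_iff[OF disj]] and m' = M'(1)[unfolded perfect_iff[OF disj]]
  have xy: "x < y" using m e by blast
  have "card (R \<inter> {x<..<y}) \<le> card (B \<inter> {x<..<y})"
  proof (rule surj_card_le[where f = "\<lambda>v. fst (inv_into M snd v)"])
    show "finite (B \<inter> {x<..<y})" by (rule finite_configuration[OF fin(2)])
    show "R \<inter> {x<..<y} \<subseteq> (\<lambda>v. fst (inv_into M snd v)) ` (B \<inter> {x<..<y})"
    proof
      fix u assume u: "u \<in> R \<inter> {x<..<y}"
      then obtain v where v: "(u, v) \<in> M" using m by force
      have "v \<le> y" using M(2) e(1) v u unfolding noncrossing_def by auto
      moreover have "v \<noteq> y" using m inj_onD[of snd M "(u, v)" "(x, y)"] e(1) v u by auto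
      moreover have "v > u" using m v by blast
      ultimately have "v \<in> B \<inter> {x<..<y}" using v u m by force
      moreover have "inv_into M snd v = (u, v)"
        using m v by (metis inv_into_f_f snd_conv)
      ultimately show "u \<in> (\<lambda>v. fst (inv_into M snd v)) ` (B \<inter> {x<..<y})" by force
    qed
  qed
  also have "\<dots> < card (B \<inter> {x<..y})"
  proof (rule psubset_card_mono)
    have "y \<in> B" using m e by force
    then show "B \<inter> {x<..<y} \<subset> B \<inter> {x<..y}" using xy by force
  qed (rule finite_configuration[OF fin(2)])
  also have "\<dots> \<le> card (R \<inter> {x<..<y})"
  proof (rule surj_card_le[where f = "\<lambda>u. snd (inv_into M' fst u)"])
    show "finite (R \<inter> {x<..<y})" by (rule finite_configuration[OF fin(1)])
    show "B \<inter> {x<..y} \<subseteq> (\<lambda>u. snd (inv_into M' fst u)) ` (R \<inter> {x<..<y})"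
    proof
      fix v assume v: "v \<in> B \<inter> {x<..y}"
      then obtain u where u: "(u, v) \<in> M'" using m' by force
      have "u < v" using u m' by blast
      moreover have "u \<noteq> x" using m' inj_onD[of fst M' "(u, v)" "(x, y')"] e(2) u v yy by auto
      \<comment> \<open>An edge of \<open>M'\<close> from before \<open>x\<close> to
        \<open>v\<close> would cross \<open>(x, y')\<close>.\<close>
      moreover have "\<not> u < x" using M'(2) e(2) u v yy unfolding noncrossing_def by fastforce
      ultimately have "u \<in> R \<inter> {x<..<y}" using v u m' by force
      moreover have "inv_into M' fst u = (u, v)"
        using m' u by (metis inv_into_f_f fst_conv)
      ultimately show "v \<in> (\<lambda>u. snd (inv_into M' fst u)) ` (R \<inter> {x<..<y})" by force
    qed
  qed
  finally show False by simp
qed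

lemma noncrossing_perfect_unique:
  assumes disj: "R \<inter> B = {}" and fin: "R \<in> configurations" "B \<in> configurations"
    and M: "perfect R B M" "noncrossing M" and M': "perfect R B M'" "noncrossing M'"
  shows "M = M'"
proof -
  have "M \<subseteq> M'" if M: "perfect R B M" "noncrossing M" and M': "perfect R B M'" "noncrossing M'" for M M'
  proof
    fix e assume e: "e \<in> M"
    obtain x y where xy: "e = (x, y)" by fastforce
    have "fst ` M = fst ` M'" using M M' by (simp add: perfect_iff[OF disj])
    then have "x \<in> fst ` M'" using e xy by (metis fst_conv imageI)
    then obtain y' where y': "(x, y') \<in> M'" by auto
    have "y' \<le> y" using noncrossing_partner_le[OF disj fin M M'] e xy y' by blast
    moreover have "y \<le> y'" using noncrossing_partner_le[OF disj fin M' M] e xy y' by blast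
    ultimately show "e \<in> M'" using y' xy by simp
  qed
  with M M' show ?thesis by blast
qed

section \<open>The walk counting reds minus blues\<close>

definition excess :: "real set \<Rightarrow> real set \<Rightarrow> real \<Rightarrow> real \<Rightarrow> int" where
  "excess R B s t = int (card (R \<inter> {s<..t})) - int (card (B \<inter> {s<..t}))"

text \<open>Intervals closed on the right make the walk right-continuous: its value at a point
  already includes the step there. It vanishes at 0.\<close>

definition walk :: "real set \<Rightarrow> real set \<Rightarrow> real \<Rightarrow> int" where
  "walk R B t = (if 0 \<le> t then excess R B 0 t else - excess R B t 0)"

lemma card_split:
  assumes "X \<in> configurations" "s \<le> t" "t \<le> u"
  shows "card (X \<inter> {s<..u}) = card (X \<inter> {s<..t}) + card (X \<inter> {t<..u})"
proof -
  have "X \<inter> {s<..u} = (X \<inter> {s<..t}) \<union> (X \<inter> {t<..u})" using assms by auto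
  then show ?thesis
    using card_Un_disjoint[OF finite_configuration(1)[OF assms(1)] finite_configuration(1)[OF assms(1)], of s t t u]
    by (simp add: disjoint_iff)
qed

lemma excess_split:
  assumes "R \<in> configurations" "B \<in> configurations" "s \<le> t" "t \<le> u"
  shows "excess R B s u = excess R B s t + excess R B t u"
  unfolding excess_def using card_split[OF assms(1,3,4)] card_split[OF assms(2-4)] by simp

lemma walk_diff:
  assumes "R \<in> configurations" "B \<in> configurations" "s \<le> t"
  shows "walk R B t = walk R B s + excess R B s t"
  using excess_split[OF assms(1,2), of 0 s t] excess_split[OF assms(1,2), of s 0 t]
    excess_split[OF assms(1,2), of s t 0] assms(3)
  by (auto simp: walk_def)

text \<open>The level \<open>m\<close> is arbitrary, so the walk is unbounded below in both
  directions. Exchanging the colours negates the walk, so unboundedness above is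
  \<open>descending B R\<close>.\<close>

locale descending =
  fixes R B :: "real set"
  assumes conf: "R \<in> configurations" "B \<in> configurations"
    and disj: "R \<inter> B = {}"
    and right: "\<exists>t\<ge>0. walk R B t < m"
    and left: "\<exists>t\<le>0. walk R B t < m"
begin

section \<open>Descent beyond any time, and the matchings that it forbids\<close>

abbreviation "W \<equiv> walk R B"

lemma fin [simp]:
  "finite (R \<inter> {s<..t})" "finite (R \<inter> {s<..<t})" "finite (R \<inter> {s..<t})" "finite (R \<inter> {s..t})"
  "finite (B \<inter> {s<..t})" "finite (B \<inter> {s<..<t})" "finite (B \<inter> {s..<t})" "finite (B \<inter> {s..t})"
  using conf by (auto intro: finite_configuration)

lemmas W_diff = walk_diff[OF conf]

text \<open>Between 0 and \<open>s\<close> the walk loses at most the number of blues in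
  \<open>{0<..s}\<close>; a value below minus that number is attained only after
  \<open>s\<close>.\<close>

lemma right': "\<exists>t>s. W t < m"
proof -
  obtain t where t: "t \<ge> 0" "W t < min m (- int (card (B \<inter> {0<..s})))" using right by blast
  have "card (B \<inter> {0<..t}) \<le> card (B \<inter> {0<..s})" if "t \<le> s"
    using that by (intro card_mono) auto
  then have "t > s" using t by (auto simp: walk_def excess_def not_less intro: ccontr)
  then show ?thesis using t by auto
qed

lemma left': "\<exists>t<s. W t < m"
proof -
  obtain t where t: "t \<le> 0" "W t < min m (- int (card (R \<inter> {s-1<..0})))" using left by blast
  have "card (R \<inter> {t<..0}) \<le> card (R \<inter> {s-1<..0})" if "s \<le> t"
    using that by (intro card_mono) auto
  moreover have "t < 0" using t by (auto simp: walk_def excess_def split: if_splits)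
  ultimately have "t < s" using t by (auto simp: walk_def excess_def not_less intro: ccontr)
  then show ?thesis using t by auto
qed

text \<open>The partners would inject the blues of \<open>{s<..t}\<close> into the reds of
  \<open>{r<..t}\<close>, so the walk could never fall below \<open>W s\<close> by more than the
  number of reds in \<open>{r<..s}\<close>.\<close>

lemma not_confined_right:
  assumes M: "red_blue_matching R B M" and rs: "r \<le> s"
    and part: "\<And>v. v \<in> B \<Longrightarrow> s < v \<Longrightarrow> \<exists>u>r. (u, v) \<in> M"
  shows False
proof -
  note m = M[unfolded red_blue_matching_iff[OF disj]]
  obtain t where t: "t > s" "W t < W s - int (card (R \<inter> {r<..s}))" using right' by blast
  have "card (B \<inter> {s<..t}) \<le> card (R \<inter> {r<..t})"
  proof (rule surj_card_le[where f = "\<lambda>u. snd (inv_into M fst u)"])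
    show "B \<inter> {s<..t} \<subseteq> (\<lambda>u. snd (inv_into M fst u)) ` (R \<inter> {r<..t})"
    proof
      fix v assume v: "v \<in> B \<inter> {s<..t}"
      then obtain u where u: "(u, v) \<in> M" "u > r" using part by auto
      have "u \<in> R" "u < v" using u m by blast+
      then have "u \<in> R \<inter> {r<..t}" using u(2) v by auto
      moreover have "inv_into M fst u = (u, v)" using m u by (metis inv_into_f_f fst_conv)
      ultimately show "v \<in> (\<lambda>u. snd (inv_into M fst u)) ` (R \<inter> {r<..t})" by force
    qed
  qed simp
  then show False
    using t W_diff[of s t] card_split[OF conf(1) rs, of t] by (simp add: excess_def)
qed

text \<open>For every \<open>t\<close> the reds strictly between \<open>t\<close> and
  \<open>s\<close> would inject into the blues of \<open>{t<..s}\<close>, so the walk could not have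
  climbed to \<open>W s\<close> from far below.\<close>

lemma not_confined_left:
  assumes M: "red_blue_matching R B M"
    and part: "\<And>u. u \<in> R \<Longrightarrow> u < s \<Longrightarrow> \<exists>v<s. (u, v) \<in> M"
  shows False
proof -
  note m = M[unfolded red_blue_matching_iff[OF disj]]
  \<comment> \<open>The extra 1 pays for a red at \<open>s\<close> itself, which
    \<open>{t<..s}\<close> counts and \<open>part\<close> does not cover.\<close>
  obtain t where t: "t < s" "W t < W s - 1" using left' by blast
  have "card (R \<inter> {t<..<s}) \<le> card (B \<inter> {t<..s})"
  proof (rule surj_card_le[where f = "\<lambda>v. fst (inv_into M snd v)"])
    show "R \<inter> {t<..<s} \<subseteq> (\<lambda>v. fst (inv_into M snd v)) ` (B \<inter> {t<..s})"
    proof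
      fix u assume u: "u \<in> R \<inter> {t<..<s}"
      then obtain v where v: "(u, v) \<in> M" "v < s" using part by auto
      have "v \<in> B" "u < v" using v m by blast+
      then have "v \<in> B \<inter> {t<..s}" using u v(2) by auto
      moreover have "inv_into M snd v = (u, v)" using m v by (metis inv_into_f_f snd_conv)
      ultimately show "u \<in> (\<lambda>v. fst (inv_into M snd v)) ` (B \<inter> {t<..s})" by force
    qed
  qed simp
  moreover have "card (R \<inter> {t<..s}) \<le> card (insert s (R \<inter> {t<..<s}))"
    by (rule card_mono) auto
  ultimately show False
    using t W_diff[of t s] by (simp add: excess_def card_insert_if split: if_splits)
qed

section \<open>The noncrossing perfect matching read off the walk\<close>

lemma next_red:
  assumes "s < t" "W s < W z" "s \<le> z" "z < t"
  shows "\<exists>r\<in>R. s < r \<and> r < t \<and> W r \<le> W s + 1"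
proof -
  have "R \<inter> {s<..z} \<noteq> {}"
    using assms(2,3) W_diff[of s z] by (auto simp: excess_def)
  \<comment> \<open>The first red after \<open>s\<close>: before it the walk can only go
    down.\<close>
  then have r: "Min (R \<inter> {s<..z}) \<in> R \<inter> {s<..z}" (is "?r \<in> _") by (intro Min_in) auto
  have "R \<inter> {s<..?r} = {?r}" using r by (force intro!: antisym[OF _ Min_le])
  then have "W ?r \<le> W s + 1" using W_diff[of s ?r] r by (auto simp: excess_def)
  then show ?thesis using r assms by (intro bexI[of _ ?r]) auto
qed

text \<open>A substitute for the left limit at \<open>x\<close>: \<open>z\<close> is the last point
  before \<open>x\<close>, or \<open>p\<close>, so only a point at \<open>x\<close> itself changes
  the walk from \<open>z\<close> to \<open>x\<close>.\<close>

lemma W_before: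
  assumes "p < x"
  shows "\<exists>z. p \<le> z \<and> z < x \<and> W x = W z + (if x \<in> R then 1 else 0) - (if x \<in> B then 1 else 0)"
proof -
  have f: "finite ((R \<union> B) \<inter> {p..<x})" by (simp add: Int_Un_distrib2)
  define z where "z = (Max (insert p ((R \<union> B) \<inter> {p..<x})))"
  have z: "z \<in> insert p ((R \<union> B) \<inter> {p..<x})" unfolding z_def using f by (intro Max_in) auto
  have le: "a \<le> z" if "a \<in> R \<union> B" "a < x" "a > p" for a
    unfolding z_def using f that by (intro Max_ge) auto
  have zx: "z < x" "p \<le> z" using z assms by auto
  have "C \<inter> {z<..x} = (if x \<in> C then {x} else {})" if "C \<subseteq> R \<union> B" for C
    using that le zx by force
  from this[of R] this[of B] show ?thesis
    using zx W_diff[of z x] by (intro exI[of _ z]) (auto simp: excess_def)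
qed

text \<open>Reds open and blues close brackets: the partner of \<open>x\<close> is the first later
  time at which the walk is below \<open>W x\<close>, the level reached by the step at
  \<open>x\<close>.\<close>

definition nested_matching :: "edge set" where
  "nested_matching = {(x, y). x \<in> R \<and> y \<in> B \<and> x < y \<and> W y = W x - 1 \<and> (\<forall>z. x \<le> z \<longrightarrow> z < y \<longrightarrow> W x \<le> W z)}"

lemma nested_matching_red:
  assumes x: "x \<in> R"
  shows "\<exists>y. (x, y) \<in> nested_matching"
proof -
  obtain t where t: "t > x" "W t < W x" using right' by blast
  \<comment> \<open>The last blue up to \<open>z\<close> is at least as low as \<open>z\<close>,
    because only reds can follow it. Hence the first low time is a blue point.\<close>
  have low: "\<exists>b\<in>B. x < b \<and> b \<le> z \<and> W b < W x" if z: "x < z" "W z < W x" for z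
  proof -
    have "B \<inter> {x<..z} \<noteq> {}" using z W_diff[of x z] by (auto simp: excess_def)
    then have b: "Max (B \<inter> {x<..z}) \<in> B \<inter> {x<..z}" (is "?b \<in> _") by (intro Max_in) auto
    have "a \<le> ?b" if "a \<in> B" "x < a" "a \<le> z" for a using that by (intro Max_ge) auto
    then have "B \<inter> {?b<..z} = {}" using b by (fastforce simp: disjoint_iff)
    then have "W ?b \<le> W z" using W_diff[of ?b z] b by (auto simp: excess_def)
    then show ?thesis using b z by auto
  qed
  let ?Y = "{b \<in> B \<inter> {x<..t}. W b < W x}"
  have fY: "finite ?Y" by (rule finite_subset[OF _ fin(5)[of x t]]) auto
  have "?Y \<noteq> {}" using low[OF t] by auto
  then have y: "Min ?Y \<in> ?Y" (is "?y \<in> _") using fY by (intro Min_in) auto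
  have above: "W x \<le> W z" if z: "x \<le> z" "z < ?y" for z
  proof (rule ccontr)
    assume "\<not> W x \<le> W z"
    then have "x < z" "W z < W x" using z by (auto simp: le_less)
    from low[OF this] obtain b where b: "b \<in> B" "x < b" "b \<le> z" "W b < W x" by auto
    then have "b \<in> ?Y" using z y by auto
    then have "?y \<le> b" using fY by (intro Min_le)
    then show False using b z by simp
  qed
  \<comment> \<open>Immediately before \<open>?y\<close> the level is still at least
    \<open>W x\<close>, and a blue point lowers it by exactly 1.\<close>
  obtain z where z: "x \<le> z" "z < ?y"
    "W ?y = W z + (if ?y \<in> R then 1 else 0) - (if ?y \<in> B then 1 else 0)"
    using W_before[of x ?y] y by auto
  have "?y \<notin> R" using y disj by auto
  then have "W ?y = W x - 1" using z y above[of z] by auto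
  then show ?thesis unfolding nested_matching_def using x y above by auto
qed

text \<open>Searching backwards, the partner is the last red before \<open>y\<close> at which the
  walk is at most \<open>W y + 1\<close>; the descent on the left ensures that there is one.\<close>

lemma nested_matching_blue:
  assumes y: "y \<in> B"
  shows "\<exists>x. (x, y) \<in> nested_matching"
proof -
  obtain t where t: "t < y" "W t < W y" using left' by blast
  have yR: "y \<notin> R" using y disj by auto
  \<comment> \<open>Just before \<open>y\<close> the walk is at \<open>W y + 1\<close>, so from a
    lower level at \<open>z\<close> it has to climb, and the first red after \<open>z\<close>
    qualifies.\<close>
  have up: "\<exists>r\<in>R. z < r \<and> r < y \<and> W r \<le> W y + 1" if z: "z < y" "W z \<le> W y" for z
  proof -
    obtain z' where "z \<le> z'" "z' < y" "W y = W z' - 1" using W_before[OF z(1)] y yR by auto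
    then show ?thesis using next_red[of z y z'] z by force
  qed
  let ?X = "{r \<in> R \<inter> {t<..<y}. W r \<le> W y + 1}"
  have fX: "finite ?X" by (rule finite_subset[OF _ fin(2)[of t y]]) auto
  have "?X \<noteq> {}" using up[of t] t by auto
  then have x: "Max ?X \<in> ?X" (is "?x \<in> _") using fX by (intro Max_in) auto
  have above: "W y + 1 \<le> W z" if z: "?x \<le> z" "z < y" for z
  proof (rule ccontr)
    assume "\<not> W y + 1 \<le> W z"
    with up[of z] z obtain r where r: "r \<in> R" "z < r" "r < y" "W r \<le> W y + 1" by auto
    then have "r \<in> ?X" using z x by auto
    then have "r \<le> ?x" using fX by (intro Max_ge)
    then show False using r z by simp
  qed
  have "W ?x = W y + 1" using above[of ?x] x by auto
  then show ?thesis unfolding nested_matching_def using x y above by auto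
qed

lemma nested_matching_perfect: "perfect R B nested_matching"
  unfolding perfect_iff[OF disj]
proof (intro conjI allI impI)
  show "inj_on fst nested_matching"
  proof (rule inj_onI, clarsimp)
    \<comment> \<open>At the earlier partner \<open>y\<close> the walk is below \<open>W x\<close>,
      which the edge to \<open>y'\<close> rules out.\<close>
    have *: False
      if e: "(x, y) \<in> nested_matching" "(x, y') \<in> nested_matching" "y < y'" for x y y'
    proof -
      have "x \<le> y" "W y = W x - 1" using e(1) by (simp_all add: nested_matching_def)
      moreover have "\<forall>z. x \<le> z \<longrightarrow> z < y' \<longrightarrow> W x \<le> W z" using e(2) by (simp add: nested_matching_def)
      ultimately show False using e(3) by force
    qed
    fix x y y' assume "(x, y) \<in> nested_matching" "(x, y') \<in> nested_matching"
    then show "y = y'" using * by (cases y y' rule: linorder_cases) blast+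
  qed
  show "inj_on snd nested_matching"
  proof (rule inj_onI, clarsimp)
    \<comment> \<open>Just before \<open>x'\<close> the walk is one below the common level
      \<open>W x = W x'\<close>, which the edge from \<open>x\<close> rules out.\<close>
    have *: False
      if e: "(x, y) \<in> nested_matching" "(x', y) \<in> nested_matching" "x < x'" for x x' y
    proof -
      have "x' \<in> R" "x' \<notin> B" using e disj by (auto simp: nested_matching_def)
      then obtain z where z: "x \<le> z" "z < x'" "W x' = W z + 1" using W_before[OF e(3)] by auto
      have "W x \<le> W z" "W x = W x'" using e z unfolding nested_matching_def by auto
      then show False using z by simp
    qed
    fix x x' y assume "(x, y) \<in> nested_matching" "(x', y) \<in> nested_matching"
    then show "x = x'" using * by (cases x x' rule: linorder_cases) blast+
  qed
  have sub: "nested_matching \<subseteq> R \<times> B" by (auto simp: nested_matching_def)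
  show "fst ` nested_matching = R"
  proof
    show "R \<subseteq> fst ` nested_matching" using nested_matching_red by (metis fst_conv imageI subsetI)
  qed (use sub in auto)
  show "snd ` nested_matching = B"
  proof
    show "B \<subseteq> snd ` nested_matching" using nested_matching_blue by (metis snd_conv imageI subsetI)
  qed (use sub in auto)
  show "x < y" if "(x, y) \<in> nested_matching" for x y
    using that by (simp add: nested_matching_def)
qed

text \<open>At \<open>y\<close> the walk has fallen to \<open>W x - 1\<close>, whereas an edge from
  \<open>x'\<close> that is still open there keeps it at \<open>W x'\<close> or above, hence at
  \<open>W x\<close> or above.\<close>

lemma nested_matching_noncrossing: "noncrossing nested_matching"
  unfolding noncrossing_def
proof (intro allI impI, rule ccontr)
  fix x y x' y'
  assume e: "(x, y) \<in> nested_matching" "(x', y') \<in> nested_matching" "x < x'" "x' < y" "\<not> y' \<le> y"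
  have "W x' \<le> W y" using e(2,4,5) by (simp add: nested_matching_def)
  moreover have "W x \<le> W x'" "W y = W x - 1" using e(1,3,4) by (simp_all add: nested_matching_def)
  ultimately show False by simp
qed

section \<open>Uncountably many perfect matchings\<close>

lemma overlapping_blues:
  assumes M: "perfect R B M"
  shows "\<exists>u v x. T < u \<and> u < v \<and> u \<in> B \<and> v \<in> B \<and> (x, v) \<in> M \<and> x < u"
proof (rule ccontr)
  \<comment> \<open>Otherwise, beyond some blue \<open>b > T\<close> every blue has its partner
    beyond \<open>b\<close>, which \<open>not_confined_right\<close> excludes.\<close>
  assume neg: "\<not> ?thesis"
  note m = M[unfolded perfect_iff[OF disj]]
  have "\<exists>b\<in>B. T < b"
  proof -
    obtain t where "t > T" "W t < W T" using right' by blast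
    then have "B \<inter> {T<..t} \<noteq> {}" using W_diff[of T t] by (auto simp: excess_def)
    then show ?thesis by auto
  qed
  then obtain b where b: "b \<in> B" "T < b" by auto
  show False
  proof (rule not_confined_right[of M b b])
    show "red_blue_matching R B M" using M by (simp add: perfect_def)
    fix v assume v: "v \<in> B" "b < v"
    then obtain x where x: "(x, v) \<in> M" using m by force
    have "x \<in> R" using m x by (metis fst_conv imageI)
    then have "x \<noteq> b" using b disj by auto
    moreover have "\<not> x < b" using neg b v x by blast
    ultimately show "\<exists>u>b. (u, v) \<in> M" using x by (intro exI[of _ x]) auto
  qed simp
qed

lemma uncountable_perfect: "uncountable {M. perfect R B M}"
proof -
  define M where "M = nested_matching"
  have M: "perfect R B M" by (simp add: M_def nested_matching_perfect)
  note m = M[unfolded perfect_iff[OF disj]]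
  \<comment> \<open>Pairs of blues that can exchange partners: the partner of the later one already
    precedes the earlier one.\<close>
  define Q where "Q p \<longleftrightarrow> fst p < snd p \<and> fst p \<in> B \<and> snd p \<in> B \<and> (\<exists>x. (x, snd p) \<in> M \<and> x < fst p)"
    for p :: "real \<times> real"
  have "\<exists>f. \<forall>n. Q (f n) \<and> snd (f n) < fst (f (Suc n))"
  proof (rule dependent_nat_choice)
    show "\<exists>p. Q p" using overlapping_blues[OF M, of 0] by (fastforce simp: Q_def)
    show "\<exists>p'. Q p' \<and> snd p < fst p'" for p
      using overlapping_blues[OF M, of "snd p"] by (fastforce simp: Q_def)
  qed
  then obtain f where f: "\<And>n. Q (f n)" "\<And>n. snd (f n) < fst (f (Suc n))" by auto
  define u v where "u n = fst (f n)" and "v n = snd (f n)" for n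
  have uv: "u n < v n" "u n \<in> B" "v n \<in> B" "\<exists>x. (x, v n) \<in> M \<and> x < u n" "v n < u (Suc n)" for n
    using f[of n] by (auto simp: Q_def u_def v_def)
  have lt: "v i < u j" if "i < j" for i j
    using that
  proof (induction j)
    case (Suc j) then show ?case using uv(1,5)[of j] uv(5)[of i] by (cases "i = j") auto
  qed simp
  have inju: "u i = u j \<longleftrightarrow> i = j" for i j
    using lt[of i j] lt[of j i] uv(1)[of i] uv(1)[of j] by (cases i j rule: linorder_cases) auto
  have injv: "v i = v j \<longleftrightarrow> i = j" for i j
    using lt[of i j] lt[of j i] uv(1)[of i] uv(1)[of j] by (cases i j rule: linorder_cases) auto
  have uv_ne: "u i \<noteq> v j" for i j
    using lt[of i j] lt[of j i] uv(1)[of i] uv(1)[of j] by (cases i j rule: linorder_cases) auto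
  have inv: "inv u (u n) = n" "inv v (v n) = n" for n
    by (auto intro!: inv_f_f injI simp: inju injv)
  \<comment> \<open>Each set \<open>A\<close> of indices gives the involution of \<open>B\<close>
    that exchanges \<open>u n\<close> and \<open>v n\<close> for all \<open>n\<close> in
    \<open>A\<close>.\<close>
  define \<tau> where "\<tau> A b = (if b \<in> u ` A then v (inv u b) else if b \<in> v ` A then u (inv v b) else b)" for A b
  have \<tau>u: "\<tau> A (u n) = (if n \<in> A then v n else u n)" for A n
    using uv_ne by (auto simp: \<tau>_def inju inv)
  have \<tau>v: "\<tau> A (v n) = (if n \<in> A then u n else v n)" for A n
    using uv_ne[THEN not_sym] by (auto simp: \<tau>_def injv inv)
  have \<tau>B: "\<tau> A b \<in> B \<longleftrightarrow> b \<in> B" for A b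
    using uv(2,3) by (auto simp: \<tau>_def inv)
  have \<tau>\<tau>: "\<tau> A (\<tau> A b) = b" for A b
  proof -
    consider n where "b = u n" "n \<in> A" | n where "b = v n" "n \<in> A" | "b \<notin> u ` A" "b \<notin> v ` A" by auto
    then show ?thesis by cases (auto simp: \<tau>u \<tau>v, auto simp: \<tau>_def)
  qed
  define N where "N A = apsnd (\<tau> A) ` M" for A
  have N: "perfect R B (N A)" for A
    unfolding perfect_iff[OF disj]
  proof (intro conjI allI impI)
    show "fst ` N A = R" using m by (simp add: N_def image_image)
    have "snd ` N A = \<tau> A ` B" using m by (force simp: N_def image_image)
    also have "\<dots> = B" using \<tau>B \<tau>\<tau> by (auto, metis imageI)
    finally show "snd ` N A = B" .
    show "inj_on fst (N A)"
      using m by (auto simp: N_def inj_on_def)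
    show "inj_on snd (N A)"
    proof (rule inj_onI)
      fix e e' assume "e \<in> N A" "e' \<in> N A" and eq: "snd e = snd e'"
      then obtain d d' where d: "d \<in> M" "e = apsnd (\<tau> A) d" "d' \<in> M" "e' = apsnd (\<tau> A) d'"
        by (auto simp: N_def)
      then have "snd d = snd d'" using eq \<tau>\<tau> by (metis snd_apsnd)
      then show "e = e'" using m d by (auto dest: inj_onD)
    qed
    fix x y assume "(x, y) \<in> N A"
    then obtain b where b: "(x, b) \<in> M" "y = \<tau> A b" by (auto simp: N_def)
    have xb: "x < b" using m b by blast
    consider n where "b = u n" "n \<in> A" | n where "b = v n" "n \<in> A" | "b \<notin> u ` A" "b \<notin> v ` A" by auto
    then show "x < y"
    proof cases
      case 1 then show ?thesis using b xb uv(1)[of n] by (simp add: \<tau>u)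
    next
      \<comment> \<open>Only here is an edge shortened; by the choice of \<open>Q\<close> the
        partner of \<open>v n\<close> lies before the new end \<open>u n\<close> as well.\<close>
      case 2
      obtain x' where "(x', v n) \<in> M" "x' < u n" using uv(4) by blast
      moreover from this have "x' = x" using m b(1) 2 inj_onD[of snd M "(x', v n)" "(x, v n)"] by auto
      ultimately show ?thesis using b 2 by (simp add: \<tau>v)
    next
      case 3 then show ?thesis using b xb by (simp add: \<tau>_def)
    qed
  qed
  have "inj N"
  proof (rule injI, rule set_eqI)
    fix A A' n assume eq: "N A = N A'"
    \<comment> \<open>The blue that is now matched to the old partner of \<open>u n\<close> reveals
      whether \<open>n\<close> belongs to the index set.\<close>
    obtain x where x: "(x, u n) \<in> M" using m uv(2)[of n] by force
    have "(x, \<tau> C (u n)) \<in> N C" for C unfolding N_def using x by force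
    then have "\<tau> A (u n) = \<tau> A' (u n)"
      using N[of A', unfolded perfect_iff[OF disj]] eq by (metis inj_onD fst_conv snd_conv)
    then show "n \<in> A \<longleftrightarrow> n \<in> A'" using uv(1)[of n] by (simp add: \<tau>u split: if_splits)
  qed
  moreover have "uncountable (UNIV :: nat set set)"
    using Cantors_theorem[of "UNIV :: nat set"]
    by (metis Pow_UNIV UNIV_I empty_not_UNIV uncountable_def)
  moreover have "range N \<subseteq> {M. perfect R B M}" using N by auto
  ultimately show ?thesis
    by (meson countable_image_inj_eq countable_subset)
qed

end

section \<open>Finite optimization\<close>

text \<open>Every edge uses two points, so fewest unmatched points means most edges.\<close>

lemma card_unmatched:
  assumes disj: "R \<inter> B = {}" and fin: "finite R" "finite B" and M: "matching R B M"
  shows "card (unmatched R B M) + 2 * card M = card R + card B"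
proof -
  note m = M[unfolded matching_iff[OF disj]]
  have sub: "fst ` M \<subseteq> R" "snd ` M \<subseteq> B" using m by auto
  have "card (fst ` M) \<le> card R" "card (snd ` M) \<le> card B"
    using sub fin by (auto intro: card_mono)
  moreover have "card (unmatched R B M) = card (R - fst ` M) + card (B - snd ` M)"
    unfolding unmatched_eq[OF disj conjunct1[OF m]] using disj fin by (intro card_Un_disjoint) auto
  moreover have "card (R - fst ` M) = card R - card (fst ` M)" "card (B - snd ` M) = card B - card (snd ` M)"
    using sub fin by (auto intro!: card_Diff_subset intro: finite_subset)
  moreover have "card (fst ` M) = card M" "card (snd ` M) = card M"
    using m by (auto intro: card_image)
  ultimately show ?thesis by simp
qed

lemma feasible_matching: "feasible \<gamma> R B M \<Longrightarrow> matching R B M"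
  by (simp add: feasible_def red_blue_matching_def split: if_splits)

lemma optimal_iff:
  assumes disj: "R \<inter> B = {}" and fin: "finite R" "finite B"
  shows "optimal \<gamma> R B M \<longleftrightarrow> feasible \<gamma> R B M \<and>
    (\<forall>M'. feasible \<gamma> R B M' \<longrightarrow> card M' \<le> card M \<and> (card M' = card M \<longrightarrow> cost \<gamma> M \<le> cost \<gamma> M'))"
proof -
  have "card (unmatched R B N) \<le> card (unmatched R B N') \<longleftrightarrow> card N' \<le> card N"
    if "feasible \<gamma> R B N" "feasible \<gamma> R B N'" for N N'
    using card_unmatched[OF disj fin feasible_matching[OF that(1)]]
      card_unmatched[OF disj fin feasible_matching[OF that(2)]] by linarith
  then have arg: "is_arg_min (\<lambda>M'. card (unmatched R B M')) (feasible \<gamma> R B) N \<longleftrightarrow>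
      feasible \<gamma> R B N \<and> (\<forall>M'. feasible \<gamma> R B M' \<longrightarrow> card M' \<le> card N)" for N
    unfolding is_arg_min_linorder by blast
  show ?thesis
    unfolding optimal_def is_arg_min_linorder[of "cost \<gamma>"] arg by (auto intro: order.antisym)
qed

section \<open>Strict concavity and convexity of the edge cost\<close>

definition len_cost :: "real \<Rightarrow> real \<Rightarrow> real" where
  "len_cost \<gamma> l = (if \<gamma> = 0 then ln l else l powr \<gamma>)"

lemma len_cost_less: "0 \<le> \<gamma> \<Longrightarrow> 0 < a \<Longrightarrow> a < b \<Longrightarrow> len_cost \<gamma> a < len_cost \<gamma> b"
  by (auto simp: len_cost_def intro: powr_less_mono2)

text \<open>Red-blue edges have finite cost, so all comparisons can be made in the reals.\<close>

lemma cost_red_blue: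
  assumes "0 \<le> \<gamma>" "\<And>x y. (x, y) \<in> M \<Longrightarrow> x < y"
  shows "cost \<gamma> M = ereal (\<Sum>(x, y)\<in>M. len_cost \<gamma> (y - x))"
proof -
  have "cost \<gamma> M = (\<Sum>(x, y)\<in>M. ereal (len_cost \<gamma> (y - x)))"
    unfolding cost_def using assms
    by (intro sum.cong refl) (auto simp: edge_cost_def len_cost_def)
  then show ?thesis by (simp add: case_prod_unfold)
qed

text \<open>The logarithm fits the pattern of the powers: its derivative is
  \<open>t powr (\<gamma> - 1)\<close> at \<open>\<gamma> = 0\<close>, with the factor 1 in place of
  \<open>\<gamma>\<close>.\<close>

lemma DERIV_len_cost:
  assumes "0 < t"
  shows "(len_cost \<gamma> has_real_derivative (if \<gamma> = 0 then 1 else \<gamma>) * t powr (\<gamma> - 1)) (at t)"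
proof (cases "\<gamma> = 0")
  case True
  then have "len_cost \<gamma> = ln" by (auto simp: len_cost_def)
  then show ?thesis using assms True DERIV_ln[of t] by (simp add: powr_minus)
next
  case False
  then have "len_cost \<gamma> = (\<lambda>t. t powr \<gamma>)" by (auto simp: len_cost_def)
  then show ?thesis using assms False has_real_derivative_powr[of t \<gamma>] by simp
qed

lemma DERIV_len_cost_diff:
  assumes "0 < t" "0 < a"
  shows "((\<lambda>t. len_cost \<gamma> (t + a) - len_cost \<gamma> t) has_real_derivative
    (if \<gamma> = 0 then 1 else \<gamma>) * ((t + a) powr (\<gamma> - 1) - t powr (\<gamma> - 1))) (at t)"
  unfolding right_diff_distrib
  by (intro DERIV_diff DERIV_len_cost[OF assms(1)] DERIV_len_cost[THEN DERIV_shift[THEN iffD1]])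
    (use assms in auto)

text \<open>Two crossing edges consist of consecutive pieces \<open>a\<close>, \<open>b\<close>,
  \<open>c\<close>. Nesting them is cheaper, because the increment caused by an extra length
  \<open>a\<close> decreases strictly with the length.\<close>

lemma len_cost_concave:
  assumes "0 \<le> \<gamma>" "\<gamma> < 1" "0 < a" "0 < b" "0 < c"
  shows "len_cost \<gamma> (a + b + c) + len_cost \<gamma> b < len_cost \<gamma> (a + b) + len_cost \<gamma> (b + c)"
proof -
  have "len_cost \<gamma> (b + c + a) - len_cost \<gamma> (b + c) < len_cost \<gamma> (b + a) - len_cost \<gamma> b"
  proof (rule DERIV_neg_imp_decreasing[of b "b + c" "\<lambda>t. len_cost \<gamma> (t + a) - len_cost \<gamma> t"])
    fix t assume "b \<le> t"
    then have t: "0 < t" using assms by simp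
    have "(t + a) powr (\<gamma> - 1) < t powr (\<gamma> - 1)"
      using t assms by (intro powr_less_mono2_neg) auto
    then have "(if \<gamma> = 0 then 1 else \<gamma>) * ((t + a) powr (\<gamma> - 1) - t powr (\<gamma> - 1)) < 0"
      using assms by (intro mult_pos_neg) auto
    with DERIV_len_cost_diff[OF t assms(3)]
    show "\<exists>y. ((\<lambda>t. len_cost \<gamma> (t + a) - len_cost \<gamma> t) has_real_derivative y) (at t) \<and> y < 0" by blast
  qed (use assms in simp)
  then show ?thesis by (simp add: ac_simps)
qed

text \<open>The same pieces with the opposite outcome: for exponents above 1 the increment
  increases, so crossing beats nesting.\<close>

lemma len_cost_convex:
  assumes "1 < \<gamma>" "0 < a" "0 < b" "0 < c"
  shows "len_cost \<gamma> (a + b) + len_cost \<gamma> (b + c) < len_cost \<gamma> (a + b + c) + len_cost \<gamma> b"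
proof -
  have "len_cost \<gamma> (b + a) - len_cost \<gamma> b < len_cost \<gamma> (b + c + a) - len_cost \<gamma> (b + c)"
  proof (rule DERIV_pos_imp_increasing[of b "b + c" "\<lambda>t. len_cost \<gamma> (t + a) - len_cost \<gamma> t"])
    fix t assume "b \<le> t"
    then have t: "0 < t" using assms by simp
    have "t powr (\<gamma> - 1) < (t + a) powr (\<gamma> - 1)"
      using t assms by (intro powr_less_mono2) auto
    then have "0 < (if \<gamma> = 0 then 1 else \<gamma>) * ((t + a) powr (\<gamma> - 1) - t powr (\<gamma> - 1))"
      using assms by (intro mult_pos_pos) auto
    with DERIV_len_cost_diff[OF t assms(2)]
    show "\<exists>y. ((\<lambda>t. len_cost \<gamma> (t + a) - len_cost \<gamma> t) has_real_derivative y) (at t) \<and> 0 < y" by blast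
  qed (use assms in simp)
  then show ?thesis by (simp add: ac_simps)
qed

section \<open>Exchange arguments in a finite optimal matching\<close>

context
  fixes R B :: "real set" and M :: "edge set" and \<gamma> :: real
  assumes disj: "R \<inter> B = {}" and fin: "finite R" "finite B"
    and \<gamma>: "0 \<le> \<gamma>" and opt: "optimal \<gamma> R B M"
begin

lemma optimal_red_blue: "red_blue_matching R B M"
  using opt \<gamma> unfolding optimal_iff[OF disj fin] feasible_def by simp

lemma finite_optimal: "finite M"
  using optimal_red_blue fin unfolding red_blue_matching_iff[OF disj]
  by (meson finite_SigmaI finite_subset)

lemma optimal_competitor:
  assumes "red_blue_matching R B M'" "card M' = card M"
  shows "(\<Sum>(x, y)\<in>M. len_cost \<gamma> (y - x)) \<le> (\<Sum>(x, y)\<in>M'. len_cost \<gamma> (y - x))"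
proof -
  have "cost \<gamma> M \<le> cost \<gamma> M'"
    using opt \<gamma> assms unfolding optimal_iff[OF disj fin] feasible_def by auto
  moreover have "x < y" if "(x, y) \<in> M'" for x y
    using assms(1) that unfolding red_blue_matching_iff[OF disj] by blast
  moreover have "x < y" if "(x, y) \<in> M" for x y
    using optimal_red_blue that unfolding red_blue_matching_iff[OF disj] by blast
  ultimately show ?thesis by (simp add: cost_red_blue[OF \<gamma>])
qed

text \<open>Exchanging the blue ends keeps the number of edges; \<open>x < y'\<close> and
  \<open>x' < y\<close> keep the edges red-blue.\<close>

lemma optimal_swap:
  assumes e: "(x, y) \<in> M" "(x', y') \<in> M" "x \<noteq> x'" "x < y'" "x' < y"
  shows "len_cost \<gamma> (y - x) + len_cost \<gamma> (y' - x') \<le> len_cost \<gamma> (y' - x) + len_cost \<gamma> (y - x')"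
proof -
  define N where "N = M - {(x, y), (x', y')}"
  have MN: "M = insert (x, y) (insert (x', y') N)" "(x, y) \<notin> N" "(x', y') \<notin> N"
    using e by (auto simp: N_def)
  note m = optimal_red_blue[unfolded red_blue_matching_iff[OF disj]]
  have finN: "finite N" using finite_optimal by (simp add: N_def)
  have f: "inj_on fst N" "inj_on snd N" "x \<notin> fst ` N" "x' \<notin> fst ` N" "y \<notin> snd ` N" "y' \<notin> snd ` N" "y \<noteq> y'"
    using m MN(2,3) e(3) unfolding MN(1) inj_on_insert by (auto simp: insert_Diff_if)
  then have nin: "(x, y') \<notin> N" "(x', y) \<notin> N" by force+
  let ?M' = "insert (x, y') (insert (x', y) N)"
  have "red_blue_matching R B ?M'"
    unfolding red_blue_matching_iff[OF disj]
  proof (intro conjI)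
    show "inj_on fst ?M'" "inj_on snd ?M'" using f e(3) by (auto simp: inj_on_insert)
    show "?M' \<subseteq> R \<times> B" using m e by (auto simp: N_def)
    show "\<forall>a b. (a, b) \<in> ?M' \<longrightarrow> a < b" using m e by (auto simp: N_def)
  qed
  moreover have "card ?M' = card M" unfolding MN(1) using finN MN(2,3) nin e(3) by simp
  ultimately have "(\<Sum>(x, y)\<in>M. len_cost \<gamma> (y - x)) \<le> (\<Sum>(x, y)\<in>?M'. len_cost \<gamma> (y - x))"
    by (rule optimal_competitor)
  then show ?thesis unfolding MN(1) using finN MN(2,3) nin e(3) by simp
qed

text \<open>If the edge covered \<open>x\<close>, moving its red end from \<open>x'\<close> to
  \<open>x\<close> would shorten it and keep the number of edges.\<close>

lemma optimal_unmatched_red: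
  assumes e: "(x', y) \<in> M" "x \<in> R" "x \<notin> fst ` M" "x' < x"
  shows "y \<le> x"
proof (rule ccontr)
  assume "\<not> y \<le> x"
  define N where "N = M - {(x', y)}"
  have MN: "M = insert (x', y) N" "(x', y) \<notin> N" using e by (auto simp: N_def)
  note m = optimal_red_blue[unfolded red_blue_matching_iff[OF disj]]
  have finN: "finite N" using finite_optimal by (simp add: N_def)
  have f: "inj_on fst N" "inj_on snd N" "x \<notin> fst ` N" "y \<notin> snd ` N"
    using m MN(2) e(3) unfolding MN(1) inj_on_insert by auto
  then have nin: "(x, y) \<notin> N" by force
  let ?M' = "insert (x, y) N"
  have "red_blue_matching R B ?M'"
    unfolding red_blue_matching_iff[OF disj]
    using f m e \<open>\<not> y \<le> x\<close> by (auto simp: inj_on_insert MN(1))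
  moreover have "card ?M' = card M" unfolding MN(1) using finN MN(2) nin by simp
  ultimately have "(\<Sum>(x, y)\<in>M. len_cost \<gamma> (y - x)) \<le> (\<Sum>(x, y)\<in>?M'. len_cost \<gamma> (y - x))"
    by (rule optimal_competitor)
  then have "len_cost \<gamma> (y - x') \<le> len_cost \<gamma> (y - x)" unfolding MN(1) using finN MN(2) nin by simp
  then show False using len_cost_less[of \<gamma> "y - x" "y - x'"] \<gamma> e(4) \<open>\<not> y \<le> x\<close> by simp
qed

text \<open>Likewise with the blue end moved from \<open>y'\<close> back to
  \<open>y\<close>.\<close>

lemma optimal_unmatched_blue:
  assumes e: "(x, y') \<in> M" "y \<in> B" "y \<notin> snd ` M" "y < y'"
  shows "y \<le> x"
proof (rule ccontr)
  assume "\<not> y \<le> x"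
  define N where "N = M - {(x, y')}"
  have MN: "M = insert (x, y') N" "(x, y') \<notin> N" using e by (auto simp: N_def)
  note m = optimal_red_blue[unfolded red_blue_matching_iff[OF disj]]
  have finN: "finite N" using finite_optimal by (simp add: N_def)
  have f: "inj_on fst N" "inj_on snd N" "y \<notin> snd ` N" "x \<notin> fst ` N"
    using m MN(2) e(3) unfolding MN(1) inj_on_insert by auto
  then have nin: "(x, y) \<notin> N" by force
  let ?M' = "insert (x, y) N"
  have "red_blue_matching R B ?M'"
    unfolding red_blue_matching_iff[OF disj]
    using f m e \<open>\<not> y \<le> x\<close> by (auto simp: inj_on_insert MN(1))
  moreover have "card ?M' = card M" unfolding MN(1) using finN MN(2) nin by simp
  ultimately have "(\<Sum>(x, y)\<in>M. len_cost \<gamma> (y - x)) \<le> (\<Sum>(x, y)\<in>?M'. len_cost \<gamma> (y - x))"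
    by (rule optimal_competitor)
  then have "len_cost \<gamma> (y' - x) \<le> len_cost \<gamma> (y - x)" unfolding MN(1) using finN MN(2) nin by simp
  then show False using len_cost_less[of \<gamma> "y - x" "y' - x"] \<gamma> e(4) \<open>\<not> y \<le> x\<close> by simp
qed

lemma optimal_noncrossing:
  assumes "\<gamma> < 1"
  shows "noncrossing M"
  unfolding noncrossing_def
proof (intro allI impI, rule ccontr)
  fix x y x' y' assume e: "(x, y) \<in> M" "(x', y') \<in> M" "x < x'" "x' < y" "\<not> y' \<le> y"
  show False
    using optimal_swap[OF e(1,2)] len_cost_concave[OF \<gamma> assms, of "x' - x" "y - x'" "y' - y"] e by simp
qed

lemma optimal_nonnesting:
  assumes "1 < \<gamma>"
  shows "nonnesting M"
  unfolding nonnesting_def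
proof (intro allI impI, rule ccontr)
  fix x y x' y' assume e: "(x, y) \<in> M" "(x', y') \<in> M" "x < x'" "\<not> y \<le> y'"
  have "x' < y'" using e(2) optimal_red_blue unfolding red_blue_matching_iff[OF disj] by blast
  then show False
    using optimal_swap[OF e(1,2)] len_cost_convex[OF assms, of "x' - x" "y' - x'" "y - y'"] e by simp
qed

end

section \<open>Finite perfect matchings that are optimal\<close>

lemma optimal_perfectI:
  assumes disj: "R \<inter> B = {}" and fin: "finite R" "finite B" and \<gamma>: "0 \<le> \<gamma>"
    and M: "perfect R B M" and le: "\<And>M'. perfect R B M' \<Longrightarrow> cost \<gamma> M \<le> cost \<gamma> M'"
  shows "optimal \<gamma> R B M"
  unfolding optimal_iff[OF disj fin]
proof (intro conjI allI impI)
  show "feasible \<gamma> R B M" using M \<gamma> by (simp add: perfect_def feasible_def)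
  fix M' assume M': "feasible \<gamma> R B M'"
  have "card (unmatched R B M') + 2 * card M' = card R + card B" "2 * card M = card R + card B"
    using card_unmatched[OF disj fin feasible_matching[OF M']]
      card_unmatched[OF disj fin, of M] M by (auto simp: perfect_def red_blue_matching_def)
  note card = this
  show "card M' \<le> card M" using card by simp
  \<comment> \<open>A competitor with as many edges leaves nothing unmatched either, so comparison
    with perfect matchings is enough.\<close>
  assume "card M' = card M"
  then have "card (unmatched R B M') = 0" using card by simp
  then have "unmatched R B M' = {}" using fin by (auto simp: unmatched_def)
  then have "perfect R B M'" using M' \<gamma> by (simp add: perfect_def feasible_def)
  then show "cost \<gamma> M \<le> cost \<gamma> M'" by (rule le)
qed

text \<open>An optimum exists among the finitely many perfect matchings; strict concavity makes it
  noncrossing, and uniqueness identifies it with \<open>M\<close>.\<close>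

lemma noncrossing_optimal:
  assumes disj: "R \<inter> B = {}" and fin: "finite R" "finite B" and \<gamma>: "0 \<le> \<gamma>" "\<gamma> < 1"
    and M: "perfect R B M" "noncrossing M"
  shows "optimal \<gamma> R B M"
proof -
  have "{M. perfect R B M} \<subseteq> Pow (R \<times> B)"
    by (auto simp: perfect_def red_blue_matching_def matching_def)
  then have "finite {M. perfect R B M}" using fin by (meson finite_Pow_iff finite_SigmaI finite_subset)
  from ex_is_arg_min_if_finite[OF this, of "cost \<gamma>"] M(1)
  obtain N where N: "perfect R B N" "\<And>M'. perfect R B M' \<Longrightarrow> cost \<gamma> N \<le> cost \<gamma> M'"
    by (auto simp: is_arg_min_linorder)
  have opt: "optimal \<gamma> R B N" by (rule optimal_perfectI[OF disj fin \<gamma>(1) N])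
  have "noncrossing N" by (rule optimal_noncrossing[OF disj fin \<gamma>(1) opt \<gamma>(2)])
  moreover have "R \<in> configurations" "B \<in> configurations" using fin by (auto simp: configurations_def)
  ultimately have "M = N" using noncrossing_perfect_unique[OF disj _ _ M N(1)] by blast
  with opt show ?thesis by simp
qed

text \<open>For exponent 1 the cost telescopes to the sum of the blue points minus the sum of the red points.\<close>

lemma perfect_optimal_1:
  assumes disj: "R \<inter> B = {}" and fin: "finite R" "finite B" and M: "perfect R B M"
  shows "optimal 1 R B M"
proof (rule optimal_perfectI[OF disj fin _ M])
  have cost: "cost 1 N = ereal (\<Sum>B - \<Sum>R)" if N: "perfect R B N" for N
  proof -
    note n = N[unfolded perfect_iff[OF disj]]
    have "cost 1 N = ereal (\<Sum>(x, y)\<in>N. len_cost 1 (y - x))"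
      using n by (intro cost_red_blue) auto
    also have "(\<Sum>(x, y)\<in>N. len_cost 1 (y - x)) = (\<Sum>e\<in>N. snd e - fst e)"
      using n by (intro sum.cong) (auto simp: len_cost_def less_imp_le)
    also have "\<dots> = \<Sum>(snd ` N) - \<Sum>(fst ` N)"
      using n sum.reindex[of snd N "\<lambda>x. x"] sum.reindex[of fst N "\<lambda>x. x"]
      by (simp only: sum_subtractf comp_def)
    finally show ?thesis using n by simp
  qed
  then show "cost 1 M \<le> cost 1 M'" if "perfect R B M'" for M' using M that by simp
qed simp

text \<open>With at least one edge the cost is minus infinity, which nothing beats; without edges an
  equally large competitor is empty too.\<close>

lemma blue_red_optimal:
  assumes disj: "R \<inter> B = {}" and fin: "finite R" "finite B" and \<gamma>: "\<gamma> < 0"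
    and M: "matching R B M" "unmatched R B M = {}" "\<And>x y. (x, y) \<in> M \<Longrightarrow> y < x"
  shows "optimal \<gamma> R B M"
  unfolding optimal_iff[OF disj fin]
proof (intro conjI allI impI)
  show "feasible \<gamma> R B M" using M \<gamma> by (simp add: feasible_def)
  fix M' assume M': "feasible \<gamma> R B M'"
  show "card M' \<le> card M"
    using card_unmatched[OF disj fin feasible_matching[OF M']] card_unmatched[OF disj fin M(1)] M(2) by simp
  assume eq: "card M' = card M"
  have finM: "finite N" if "matching R B N" for N
    using that fin unfolding matching_def by (meson finite_SigmaI finite_subset)
  have "cost \<gamma> M = (\<Sum>e\<in>M. - \<infinity>)"
    unfolding cost_def by (intro sum.cong) (use M(3) \<gamma> in \<open>force simp: edge_cost_def\<close>)+
  moreover have "(\<Sum>e\<in>M. - \<infinity> :: ereal) = - \<infinity>" if "M \<noteq> {}"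
    using finM[OF M(1)] that by (induction M rule: finite_ne_induct) auto
  moreover have "M' = {}" if "M = {}" using that eq finM[OF feasible_matching[OF M']] by simp
  ultimately show "cost \<gamma> M \<le> cost \<gamma> M'" by (cases "M = {}") auto
qed

section \<open>Minimal matchings\<close>

lemma finite_admissible: "admissible R B M S \<Longrightarrow> finite S"
  by (simp add: admissible_def)

text \<open>As \<open>M\<close> leaves no point unmatched, a test set is a union of edges of
  \<open>M\<close>, and all of them survive the restriction.\<close>

lemma restrict_matching_full:
  assumes disj: "R \<inter> B = {}" and M: "matching R B M" "unmatched R B M = {}" and S: "admissible R B M S"
  shows "finite (R \<inter> S)" "finite (B \<inter> S)" "matching (R \<inter> S) (B \<inter> S) (restrict_matching M S)"
    "unmatched (R \<inter> S) (B \<inter> S) (restrict_matching M S) = {}"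
proof -
  show "finite (R \<inter> S)" "finite (B \<inter> S)" using finite_admissible[OF S] by auto
  show "matching (R \<inter> S) (B \<inter> S) (restrict_matching M S)"
    unfolding matching_def
  proof
    show "restrict_matching M S \<subseteq> (R \<inter> S) \<times> (B \<inter> S)"
      using M(1) by (auto simp: matching_def restrict_matching_def endpoints_def)
    show "disjoint_family_on endpoints (restrict_matching M S)"
      using M(1) by (auto simp: matching_def restrict_matching_def intro: disjoint_family_on_mono)
  qed
  obtain E where E: "E \<subseteq> M" "S = (\<Union>e\<in>E. endpoints e)"
    using S M(2) by (auto simp: admissible_def)
  then have "E \<subseteq> restrict_matching M S" by (auto simp: restrict_matching_def)
  then show "unmatched (R \<inter> S) (B \<inter> S) (restrict_matching M S) = {}"
    using E(2) by (auto simp: unmatched_def)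
qed

lemma perfect_restrict:
  assumes disj: "R \<inter> B = {}" and M: "perfect R B M" and S: "admissible R B M S"
  shows "perfect (R \<inter> S) (B \<inter> S) (restrict_matching M S)"
  using restrict_matching_full[OF disj _ _ S] M
  by (auto simp: perfect_def red_blue_matching_def restrict_matching_def)

section \<open>Perfect matchings that are minimal\<close>

lemma perfect_minimal_1:
  assumes disj: "R \<inter> B = {}" and M: "perfect R B M"
  shows "minimal_matching 1 R B M"
  unfolding minimal_matching_def
proof (intro conjI allI impI)
  show "feasible 1 R B M" using M by (simp add: perfect_def feasible_def)
  fix S assume S: "admissible R B M S"
  then show "optimal 1 (R \<inter> S) (B \<inter> S) (restrict_matching M S)"
    using disj finite_admissible[OF S] by (intro perfect_optimal_1 perfect_restrict[OF disj M S]) auto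
qed

lemma noncrossing_optimal_restrict:
  assumes disj: "R \<inter> B = {}" and M: "perfect R B M" "noncrossing M" and \<gamma>: "0 \<le> \<gamma>" "\<gamma> < 1"
    and S: "admissible R B M S"
  shows "optimal \<gamma> (R \<inter> S) (B \<inter> S) (restrict_matching M S)"
proof (intro noncrossing_optimal perfect_restrict[OF disj M(1) S] \<gamma>)
  show "noncrossing (restrict_matching M S)"
    using M(2) unfolding noncrossing_def restrict_matching_def by blast
qed (use disj finite_admissible[OF S] in auto)

lemma blue_red_minimal:
  assumes disj: "R \<inter> B = {}" and \<gamma>: "\<gamma> < 0"
    and M: "matching R B M" "unmatched R B M = {}" "\<And>x y. (x, y) \<in> M \<Longrightarrow> y < x"
  shows "minimal_matching \<gamma> R B M"
  unfolding minimal_matching_def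
proof (intro conjI allI impI)
  show "feasible \<gamma> R B M" using M \<gamma> by (simp add: feasible_def)
  fix S assume S: "admissible R B M S"
  show "optimal \<gamma> (R \<inter> S) (B \<inter> S) (restrict_matching M S)"
    using disj M(3)
    by (intro blue_red_optimal restrict_matching_full[OF disj M(1,2) S] \<gamma>) (auto simp: restrict_matching_def)
qed

lemma matching_converse:
  assumes disj: "R \<inter> B = {}" and M: "matching R B M"
  shows "matching B R (M\<inverse>)"
proof -
  note m = M[unfolded matching_iff[OF disj]]
  have swap: "prod.swap e \<in> M" if "e \<in> M\<inverse>" for e using that by (cases e) simp
  have "inj_on fst (M\<inverse>)"
  proof (rule inj_onI)
    fix e e' assume "e \<in> M\<inverse>" "e' \<in> M\<inverse>" "fst e = fst e'"
    then have "prod.swap e = prod.swap e'" using m swap by (intro inj_onD[of snd M]) auto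
    then show "e = e'" by (metis swap_swap)
  qed
  moreover have "inj_on snd (M\<inverse>)"
  proof (rule inj_onI)
    fix e e' assume "e \<in> M\<inverse>" "e' \<in> M\<inverse>" "snd e = snd e'"
    then have "prod.swap e = prod.swap e'" using m swap by (intro inj_onD[of fst M]) auto
    then show "e = e'" by (metis swap_swap)
  qed
  moreover have "M\<inverse> \<subseteq> B \<times> R" using m by auto
  moreover have "B \<inter> R = {}" using disj by auto
  ultimately show ?thesis by (simp add: matching_iff)
qed

lemma unmatched_converse: "unmatched B R (M\<inverse>) = unmatched R B M"
  unfolding unmatched_def endpoints_def by fastforce

text \<open>
  Optimality for some exponent in \<open>\<Gamma>\<close>, depending on the test set, is all that the exponents \<open>\<gamma>\<close>, \<open>1\<^sup>+\<close>
  and \<open>1\<^sup>-\<close> have in common.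
\<close>

definition locally_optimal :: "real set \<Rightarrow> real set \<Rightarrow> real set \<Rightarrow> edge set \<Rightarrow> bool" where
  "locally_optimal \<Gamma> R B M \<longleftrightarrow> red_blue_matching R B M \<and>
    (\<forall>S. admissible R B M S \<longrightarrow> (\<exists>\<gamma>\<in>\<Gamma>. optimal \<gamma> (R \<inter> S) (B \<inter> S) (restrict_matching M S)))"

lemma minimal_locally_optimal:
  assumes "0 \<le> \<gamma>" "minimal_matching \<gamma> R B M"
  shows "locally_optimal {\<gamma>} R B M"
  using assms by (simp add: locally_optimal_def minimal_matching_def feasible_def)

text \<open>The filter is not trivial, so what holds for all exponents close enough to 1 holds for
  at least one of them.\<close>

lemma minimal_1plus_locally_optimal:
  assumes "minimal_matching_1plus R B M"
  shows "locally_optimal {1<..} R B M"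
  unfolding locally_optimal_def
proof (intro conjI allI impI)
  fix S assume "admissible R B M S"
  then have "\<forall>\<^sub>F \<gamma> in at_right 1. optimal \<gamma> (R \<inter> S) (B \<inter> S) (restrict_matching M S)"
    using assms by (auto simp: minimal_matching_1plus_def)
  moreover have "\<forall>\<^sub>F \<gamma> in at_right 1. (\<gamma>::real) \<in> {1<..}" by (simp add: eventually_at_right_less)
  ultimately have "\<forall>\<^sub>F \<gamma> in at_right 1. \<gamma> \<in> {1<..} \<and> optimal \<gamma> (R \<inter> S) (B \<inter> S) (restrict_matching M S)"
    by eventually_elim auto
  from eventually_happens[OF this]
  show "\<exists>\<gamma>\<in>{1<..}. optimal \<gamma> (R \<inter> S) (B \<inter> S) (restrict_matching M S)" by auto
qed (use assms in \<open>simp add: minimal_matching_1plus_def\<close>)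

text \<open>Exponents close to 1 on the left are also nonnegative, hence in the range of strict
  concavity.\<close>

lemma minimal_1minus_locally_optimal:
  assumes "minimal_matching_1minus R B M"
  shows "locally_optimal {0..<1} R B M"
  unfolding locally_optimal_def
proof (intro conjI allI impI)
  fix S assume "admissible R B M S"
  then have "\<forall>\<^sub>F \<gamma> in at_left 1. optimal \<gamma> (R \<inter> S) (B \<inter> S) (restrict_matching M S)"
    using assms by (auto simp: minimal_matching_1minus_def)
  moreover have "\<forall>\<^sub>F \<gamma> in at_left 1. (\<gamma>::real) \<in> {0<..<1}" by (rule eventually_at_left_real) simp
  ultimately have "\<forall>\<^sub>F \<gamma> in at_left 1. \<gamma> \<in> {0..<1} \<and> optimal \<gamma> (R \<inter> S) (B \<inter> S) (restrict_matching M S)"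
    by eventually_elim auto
  from eventually_happens[OF this]
  show "\<exists>\<gamma>\<in>{0..<1}. optimal \<gamma> (R \<inter> S) (B \<inter> S) (restrict_matching M S)" by auto
qed (use assms in \<open>simp add: minimal_matching_1minus_def\<close>)

section \<open>Local optimality on test sets of at most two edges and some unmatched points\<close>

lemma locally_optimal_edge:
  assumes opt: "locally_optimal \<Gamma> R B M" and e: "e \<in> M" and U: "U \<subseteq> unmatched R B M" "finite U"
  obtains \<gamma> where "\<gamma> \<in> \<Gamma>"
    "optimal \<gamma> (R \<inter> (endpoints e \<union> U)) (B \<inter> (endpoints e \<union> U)) (restrict_matching M (endpoints e \<union> U))"
proof -
  have "admissible R B M (endpoints e \<union> U)"
    unfolding admissible_def
  proof (intro conjI exI)
    show "{e} \<subseteq> M" using e by simp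
  qed (use U in \<open>auto simp: endpoints_def\<close>)
  then show ?thesis using opt that unfolding locally_optimal_def by blast
qed

lemma locally_optimal_edges:
  assumes opt: "locally_optimal \<Gamma> R B M" and e: "e \<in> M" "e' \<in> M"
  defines "S \<equiv> endpoints e \<union> endpoints e'"
  obtains \<gamma> where "\<gamma> \<in> \<Gamma>" "optimal \<gamma> (R \<inter> S) (B \<inter> S) (restrict_matching M S)"
    "e \<in> restrict_matching M S" "e' \<in> restrict_matching M S"
proof -
  have "admissible R B M S"
    unfolding admissible_def
  proof (intro conjI exI)
    show "{e, e'} \<subseteq> M" "{} \<subseteq> unmatched R B M" using e by simp_all
  qed (auto simp: endpoints_def S_def)
  moreover have "e \<in> restrict_matching M S" "e' \<in> restrict_matching M S"
    using e by (auto simp: restrict_matching_def S_def)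
  ultimately show ?thesis using opt that unfolding locally_optimal_def by blast
qed

text \<open>Crossing concerns two edges only, whose ends form a test set; the exponent may vary with
  the pair.\<close>

lemma locally_optimal_noncrossing:
  assumes disj: "R \<inter> B = {}" and \<Gamma>: "\<Gamma> \<subseteq> {0..<1}" and opt: "locally_optimal \<Gamma> R B M"
  shows "noncrossing M"
  unfolding noncrossing_def
proof (intro allI impI)
  fix x y x' y' assume e: "(x, y) \<in> M" "(x', y') \<in> M" "x < x'" "x' < y"
  let ?S = "endpoints (x, y) \<union> endpoints (x', y')"
  obtain \<gamma> where \<gamma>: "\<gamma> \<in> \<Gamma>" "optimal \<gamma> (R \<inter> ?S) (B \<inter> ?S) (restrict_matching M ?S)"
    "(x, y) \<in> restrict_matching M ?S" "(x', y') \<in> restrict_matching M ?S"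
    using locally_optimal_edges[OF opt e(1,2)] by blast
  have "noncrossing (restrict_matching M ?S)"
    using disj \<gamma>(1) \<Gamma> by (intro optimal_noncrossing[OF _ _ _ _ \<gamma>(2)]) (auto simp: endpoints_def)
  then show "y' \<le> y" using \<gamma>(3,4) e(3,4) unfolding noncrossing_def by blast
qed

lemma locally_optimal_nonnesting:
  assumes disj: "R \<inter> B = {}" and \<Gamma>: "\<Gamma> \<subseteq> {1<..}" and opt: "locally_optimal \<Gamma> R B M"
  shows "nonnesting M"
  unfolding nonnesting_def
proof (intro allI impI)
  fix x y x' y' assume e: "(x, y) \<in> M" "(x', y') \<in> M" "x < x'"
  let ?S = "endpoints (x, y) \<union> endpoints (x', y')"
  obtain \<gamma> where \<gamma>: "\<gamma> \<in> \<Gamma>" "optimal \<gamma> (R \<inter> ?S) (B \<inter> ?S) (restrict_matching M ?S)"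
    "(x, y) \<in> restrict_matching M ?S" "(x', y') \<in> restrict_matching M ?S"
    using locally_optimal_edges[OF opt e(1,2)] by blast
  have "nonnesting (restrict_matching M ?S)"
    using disj \<gamma>(1) \<Gamma> by (intro optimal_nonnesting[OF _ _ _ _ \<gamma>(2)]) (auto simp: endpoints_def)
  then show "y \<le> y'" using \<gamma>(3,4) e(3) unfolding nonnesting_def by blast
qed

text \<open>Otherwise \<open>{x, y}\<close> would be a test set on which \<open>M\<close> has no
  edge although \<open>(x, y)\<close> is available.\<close>

lemma locally_optimal_unmatched_pair:
  assumes disj: "R \<inter> B = {}" and \<Gamma>: "\<Gamma> \<subseteq> {0..}" and opt: "locally_optimal \<Gamma> R B M"
    and xy: "x \<in> R" "y \<in> B" "x < y" "x \<notin> fst ` M"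
  shows "y \<in> snd ` M"
proof (rule ccontr)
  assume y: "y \<notin> snd ` M"
  have MRB: "M \<subseteq> R \<times> B"
    using opt unfolding locally_optimal_def red_blue_matching_iff[OF disj] by blast
  then have "{x, y} \<subseteq> unmatched R B M" using xy y unmatched_eq[OF disj MRB] by auto
  then have "admissible R B M {x, y}"
    unfolding admissible_def by (intro conjI exI[of _ "{}"] exI[of _ "{x, y}"]) auto
  then obtain \<gamma> where \<gamma>: "\<gamma> \<in> \<Gamma>" "optimal \<gamma> (R \<inter> {x, y}) (B \<inter> {x, y}) (restrict_matching M {x, y})"
    using opt unfolding locally_optimal_def by blast
  have RB: "R \<inter> {x, y} = {x}" "B \<inter> {x, y} = {y}" using xy disj by auto
  have sing: "{x} \<inter> {y} = {}" using xy by auto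
  have "feasible \<gamma> {x} {y} {(x, y)}"
    using \<gamma>(1) \<Gamma> xy unfolding feasible_def red_blue_matching_iff[OF sing] by auto
  then have "card {(x, y)} \<le> card (restrict_matching M {x, y})"
    using \<gamma>(2) unfolding RB optimal_iff[OF sing finite.insertI[OF finite.emptyI] finite.insertI[OF finite.emptyI]] by blast
  moreover have "restrict_matching M {x, y} = {}"
    using xy(4) y MRB xy disj by (force simp: restrict_matching_def endpoints_def)
  ultimately show False by simp
qed

lemma locally_optimal_unmatched_red:
  assumes disj: "R \<inter> B = {}" and \<Gamma>: "\<Gamma> \<subseteq> {0..}" and opt: "locally_optimal \<Gamma> R B M"
    and e: "(x', y) \<in> M" "x \<in> R" "x \<notin> fst ` M" "x' < x"
  shows "y \<le> x"
proof -
  let ?S = "endpoints (x', y) \<union> {x}"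
  have MRB: "M \<subseteq> R \<times> B"
    using opt unfolding locally_optimal_def red_blue_matching_iff[OF disj] by blast
  then have "{x} \<subseteq> unmatched R B M" using e unmatched_eq[OF disj MRB] by auto
  then obtain \<gamma> where \<gamma>: "\<gamma> \<in> \<Gamma>" "optimal \<gamma> (R \<inter> ?S) (B \<inter> ?S) (restrict_matching M ?S)"
    using locally_optimal_edge[OF opt e(1)] by blast
  have S: "R \<inter> ?S \<inter> (B \<inter> ?S) = {}" "finite (R \<inter> ?S)" "finite (B \<inter> ?S)" "0 \<le> \<gamma>"
    using disj \<gamma>(1) \<Gamma> by (auto simp: endpoints_def)
  have "(x', y) \<in> restrict_matching M ?S" "x \<in> R \<inter> ?S" "x \<notin> fst ` restrict_matching M ?S"
    using e by (auto simp: restrict_matching_def)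
  then show ?thesis
    by (rule optimal_unmatched_red[OF S \<gamma>(2)]) (rule e(4))
qed

lemma locally_optimal_unmatched_blue:
  assumes disj: "R \<inter> B = {}" and \<Gamma>: "\<Gamma> \<subseteq> {0..}" and opt: "locally_optimal \<Gamma> R B M"
    and e: "(x, y') \<in> M" "y \<in> B" "y \<notin> snd ` M" "y < y'"
  shows "y \<le> x"
proof -
  let ?S = "endpoints (x, y') \<union> {y}"
  have MRB: "M \<subseteq> R \<times> B"
    using opt unfolding locally_optimal_def red_blue_matching_iff[OF disj] by blast
  then have "{y} \<subseteq> unmatched R B M" using e unmatched_eq[OF disj MRB] by auto
  then obtain \<gamma> where \<gamma>: "\<gamma> \<in> \<Gamma>" "optimal \<gamma> (R \<inter> ?S) (B \<inter> ?S) (restrict_matching M ?S)"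
    using locally_optimal_edge[OF opt e(1)] by blast
  have S: "R \<inter> ?S \<inter> (B \<inter> ?S) = {}" "finite (R \<inter> ?S)" "finite (B \<inter> ?S)" "0 \<le> \<gamma>"
    using disj \<gamma>(1) \<Gamma> by (auto simp: endpoints_def)
  have "(x, y') \<in> restrict_matching M ?S" "y \<in> B \<inter> ?S" "y \<notin> snd ` restrict_matching M ?S"
    using e by (auto simp: restrict_matching_def)
  then show ?thesis
    by (rule optimal_unmatched_blue[OF S \<gamma>(2)]) (rule e(4))
qed

section \<open>Minimal matchings over a descending walk\<close>

context descending
begin

text \<open>Beyond an unmatched red \<open>x\<close> all blues are matched, and no edge covers
  \<open>x\<close>, so their partners also lie beyond \<open>x\<close>, which
  \<open>not_confined_right\<close> excludes. Once all reds are known to be matched,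
  \<open>not_confined_left\<close> excludes unmatched blues in the same way.\<close>

lemma locally_optimal_perfect:
  assumes \<Gamma>: "\<Gamma> \<subseteq> {0..}" and opt: "locally_optimal \<Gamma> R B M"
  shows "perfect R B M"
proof -
  have M: "red_blue_matching R B M" using opt by (simp add: locally_optimal_def)
  note m = M[unfolded red_blue_matching_iff[OF disj]]
  have red: "x \<in> fst ` M" if x: "x \<in> R" for x
  proof (rule ccontr)
    assume nx: "x \<notin> fst ` M"
    show False
    proof (rule not_confined_right[OF M order.refl, of x])
      fix v assume v: "v \<in> B" "x < v"
      then obtain u where u: "(u, v) \<in> M"
        using locally_optimal_unmatched_pair[OF disj \<Gamma> opt x _ _ nx] by force
      moreover have "u \<noteq> x" using u nx by force
      moreover have "\<not> u < x"
        using locally_optimal_unmatched_red[OF disj \<Gamma> opt u x nx] v by linarith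
      ultimately show "\<exists>u>x. (u, v) \<in> M" by (intro exI[of _ u]) auto
    qed
  qed
  have blue: "y \<in> snd ` M" if y: "y \<in> B" for y
  proof (rule ccontr)
    assume ny: "y \<notin> snd ` M"
    show False
    proof (rule not_confined_left[OF M, of y])
      fix u assume u: "u \<in> R" "u < y"
      then obtain v where v: "(u, v) \<in> M" using red by force
      moreover have "v \<noteq> y" using v ny by force
      moreover have "\<not> y < v"
        using locally_optimal_unmatched_blue[OF disj \<Gamma> opt v y ny] u by linarith
      ultimately show "\<exists>v<y. (u, v) \<in> M" by (intro exI[of _ v]) auto
    qed
  qed
  show ?thesis
    unfolding perfect_def unmatched_eq[OF disj conjunct1[OF m]] using M red blue by blast
qed

text \<open>A nonnesting matching preserves order, so the partners of all blues beyond one edge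
  \<open>(x, y)\<close> lie beyond \<open>x\<close>, contrary to the descent of the walk.\<close>

lemma not_locally_optimal_convex:
  assumes \<Gamma>: "\<Gamma> \<subseteq> {1<..}"
  shows "\<not> locally_optimal \<Gamma> R B M"
proof
  assume opt: "locally_optimal \<Gamma> R B M"
  have "\<Gamma> \<subseteq> {0..}" using \<Gamma> by force
  then have M: "perfect R B M" using opt by (rule locally_optimal_perfect)
  note m = M[unfolded perfect_iff[OF disj]]
  have nest: "nonnesting M" by (rule locally_optimal_nonnesting[OF disj \<Gamma> opt])
  \<comment> \<open>\<open>overlapping_blues\<close> supplies the existence of an edge.\<close>
  obtain x y where xy: "(x, y) \<in> M" using overlapping_blues[OF M, of 0] by blast
  then have le: "x \<le> y" using m less_imp_le by blast
  have rb: "red_blue_matching R B M" using M by (simp add: perfect_def)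
  show False
  proof (rule not_confined_right[OF rb le])
    fix v assume v: "v \<in> B" "y < v"
    then obtain u where u: "(u, v) \<in> M" using m by force
    have "u \<noteq> x" using m u xy v inj_onD[of fst M "(u, v)" "(x, y)"] by auto
    moreover have "\<not> u < x" using nest u xy v unfolding nonnesting_def by force
    ultimately show "\<exists>u>x. (u, v) \<in> M" using u by (intro exI[of _ u]) auto
  qed
qed

lemma locally_optimal_concave_unique:
  assumes \<Gamma>: "\<Gamma> \<subseteq> {0..<1}" and opt: "locally_optimal \<Gamma> R B M"
  shows "M = nested_matching"
proof (rule noncrossing_perfect_unique[OF disj conf])
  have "\<Gamma> \<subseteq> {0..}" using \<Gamma> by force
  then show "perfect R B M" using opt by (rule locally_optimal_perfect)
  show "noncrossing M" by (rule locally_optimal_noncrossing[OF disj \<Gamma> opt])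
qed (rule nested_matching_perfect nested_matching_noncrossing)+

lemma unique_minimal_concave:
  assumes "0 \<le> \<gamma>" "\<gamma> < 1"
  shows "\<exists>!M. minimal_matching \<gamma> R B M"
proof (rule ex1I)
  show "minimal_matching \<gamma> R B nested_matching"
    using nested_matching_perfect assms
      noncrossing_optimal_restrict[OF disj nested_matching_perfect nested_matching_noncrossing]
    by (auto simp: minimal_matching_def feasible_def perfect_def)
  show "M = nested_matching" if "minimal_matching \<gamma> R B M" for M
    using that assms by (intro locally_optimal_concave_unique[of "{\<gamma>}"] minimal_locally_optimal) auto
qed

lemma unique_minimal_1minus: "\<exists>!M. minimal_matching_1minus R B M"
proof (rule ex1I)
  have "\<forall>\<^sub>F \<gamma> in at_left 1. optimal \<gamma> (R \<inter> S) (B \<inter> S) (restrict_matching nested_matching S)"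
    if S: "admissible R B nested_matching S" for S
  proof -
    have "\<forall>\<^sub>F \<gamma> in at_left 1. (\<gamma>::real) \<in> {0<..<1}" by (rule eventually_at_left_real) simp
    then show ?thesis
    proof eventually_elim
      case (elim \<gamma>)
      then show ?case
        using noncrossing_optimal_restrict[OF disj nested_matching_perfect nested_matching_noncrossing _ _ S] by simp
    qed
  qed
  then show "minimal_matching_1minus R B nested_matching"
    using nested_matching_perfect by (auto simp: minimal_matching_1minus_def perfect_def)
  show "M = nested_matching" if "minimal_matching_1minus R B M" for M
    using that by (intro locally_optimal_concave_unique[OF order.refl] minimal_1minus_locally_optimal)
qed

lemma uncountable_minimal_1: "uncountable {M. minimal_matching 1 R B M}"
proof
  assume "countable {M. minimal_matching 1 R B M}"
  moreover have "{M. perfect R B M} \<subseteq> {M. minimal_matching 1 R B M}"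
    using perfect_minimal_1[OF disj] by auto
  ultimately show False using uncountable_perfect by (auto dest: countable_subset)
qed

text \<open>The colours are exchanged: reversing a perfect red-blue matching between
  \<open>R\<close> and \<open>B\<close> gives a perfect matching between \<open>B\<close> and
  \<open>R\<close> whose edges all cost minus infinity.\<close>

lemma uncountable_minimal_negative:
  assumes "\<gamma> < 0"
  shows "uncountable {M. minimal_matching \<gamma> B R M}"
proof -
  have "converse ` {M. perfect R B M} \<subseteq> {M. minimal_matching \<gamma> B R M}"
  proof clarify
    fix M assume M: "perfect R B M"
    show "minimal_matching \<gamma> B R (M\<inverse>)"
    proof (rule blue_red_minimal[OF _ assms])
      show "matching B R (M\<inverse>)" "unmatched B R (M\<inverse>) = {}"
        using M by (simp_all add: matching_converse[OF disj] unmatched_converse perfect_def red_blue_matching_def)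
      show "y < x" if "(x, y) \<in> M\<inverse>" for x y
        using M that by (auto simp: perfect_iff[OF disj])
    qed (use disj in auto)
  qed
  moreover have "inj_on converse {M. perfect R B M}" by (rule inj_onI) (metis converse_converse)
  then have "uncountable (converse ` {M. perfect R B M})"
    using uncountable_perfect by (simp add: countable_image_inj_eq)
  ultimately show ?thesis by (auto dest: countable_subset)
qed

end

text \<open>The theorem for a single realization; \<open>descending B R\<close> yields the negative
  exponents.\<close>

lemma minimal_matchings_description:
  assumes "descending R B" "descending B R"
  shows "(\<forall>\<gamma><0. uncountable {M. minimal_matching \<gamma> R B M}) \<and>
    ((\<forall>\<gamma>\<in>{0..<1}. \<exists>!M. minimal_matching \<gamma> R B M) \<and>
     (\<exists>!M. minimal_matching_1minus R B M)) \<and>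
    uncountable {M. minimal_matching 1 R B M} \<and>
    ((\<nexists>M. minimal_matching_1plus R B M) \<and>
     (\<forall>\<gamma>>1. \<nexists>M. minimal_matching \<gamma> R B M))"
proof -
  interpret descending R B by fact
  have "\<nexists>M. minimal_matching \<gamma> R B M" if "\<gamma> > 1" for \<gamma>
    using minimal_locally_optimal[of \<gamma> R B] not_locally_optimal_convex[of "{\<gamma>}"] that by auto
  moreover have "\<nexists>M. minimal_matching_1plus R B M"
    using minimal_1plus_locally_optimal[of R B] not_locally_optimal_convex[of "{1<..}"] by auto
  moreover have "\<exists>!M. minimal_matching \<gamma> R B M" if "\<gamma> \<in> {0..<1}" for \<gamma>
    using unique_minimal_concave that by simp
  ultimately show ?thesis
    using descending.uncountable_minimal_negative[OF assms(2)] unique_minimal_1minus uncountable_minimal_1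
    by (intro conjI allI ballI impI)
qed

section \<open>Anticoncentration of the Poisson distribution\<close>

lemma sum_pmf_le_1: "finite A \<Longrightarrow> (\<Sum>k\<in>A. pmf p k) \<le> 1"
  using measure_measure_pmf_finite[of A p] measure_pmf.prob_le_1[of p A] by simp

text \<open>
  Within distance \<open>m\<close> of \<open>k\<close>, on the side of the mean, every atom is at least half the atom at \<open>k\<close>.
\<close>

lemma poisson_atom_le:
  assumes \<mu>: "real m < \<mu>" and half: "1 / 2 \<le> (1 - real m / \<mu>) ^ m"
  shows "pmf (poisson_pmf \<mu>) k \<le> 2 / (real m + 1)"
proof -
  have pos: "\<mu> > 0" using \<mu> by (meson of_nat_0_le_iff le_less_trans)
  \<comment> \<open>A lower bound for the ratio of successive atoms on at most \<open>m\<close>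
    steps from \<open>k\<close> in the direction of the mean, possibly past it.\<close>
  define q where "q = 1 - real m / \<mu>"
  define p where "p = pmf (poisson_pmf \<mu>)"
  have q: "0 \<le> q" "q \<le> 1" using \<mu> pos by (auto simp: q_def field_simps)
  have p_pos: "0 \<le> p i" for i by (simp add: p_def)
  have p_Suc: "p (Suc i) * real (Suc i) = p i * \<mu>" for i
    using pos by (simp add: p_def field_simps del: of_nat_Suc)
  have "\<exists>A. finite A \<and> card A = Suc m \<and> (\<forall>i\<in>A. q ^ m * p k \<le> p i)"
  proof (cases "\<mu> \<le> real k")
    case True
    then have mk: "m \<le> k" using \<mu> by linarith
    have step: "q ^ j * p k \<le> p (k - j)" if "j \<le> m" for j
      using that
    proof (induction j)
      case (Suc j)
      have kj: "k - j = Suc (k - Suc j)" using Suc.prems mk by simp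
      have "\<mu> * q = \<mu> - m" using pos by (simp add: q_def field_simps)
      also have "\<dots> \<le> real (k - j)" using Suc.prems mk True by (simp add: of_nat_diff)
      finally have "\<mu> * q * p (k - j) \<le> real (k - j) * p (k - j)" by (intro mult_right_mono p_pos)
      also have "\<dots> = \<mu> * p (k - Suc j)" using p_Suc[of "k - Suc j"] unfolding kj by (simp add: mult.commute)
      finally have "q * p (k - j) \<le> p (k - Suc j)" using pos by (simp add: mult.assoc)
      moreover have "q * (q ^ j * p k) \<le> q * p (k - j)" using Suc q by (intro mult_left_mono) auto
      ultimately show ?case by (simp add: mult.assoc)
    qed simp
    have "q ^ m * p k \<le> p i" if i: "i \<in> {k - m..k}" for i
    proof -
      have "q ^ m * p k \<le> q ^ (k - i) * p k"
        using i q by (intro mult_right_mono power_decreasing p_pos) auto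
      moreover have "k - i \<le> m" using i by (simp add: le_diff_conv)
      ultimately show ?thesis using step[of "k - i"] i by simp
    qed
    then show ?thesis using mk by (intro exI[of _ "{k - m..k}"]) auto
  next
    case False
    have step: "q ^ j * p k \<le> p (k + j)" if "j \<le> m" for j
      using that
    proof (induction j)
      case (Suc j)
      have "real (Suc (k + j)) * q \<le> (\<mu> + m) * q"
        using Suc.prems False q by (intro mult_right_mono) auto
      \<comment> \<open>Multiplied by \<open>\<mu>\<close> this is
        \<open>(\<mu> + m) * (\<mu> - m) \<le> \<mu>\<^sup>2\<close>.\<close>
      also have "\<dots> \<le> \<mu>" using pos by (simp add: q_def field_simps)
      finally have "real (Suc (k + j)) * q * p (k + j) \<le> \<mu> * p (k + j)" by (intro mult_right_mono p_pos)
      also have "\<dots> = real (Suc (k + j)) * p (Suc (k + j))" using p_Suc[of "k + j"] by (simp only: mult.commute)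
      finally have "q * p (k + j) \<le> p (Suc (k + j))"
        by (simp only: mult.assoc) (metis mult_le_cancel_left_pos of_nat_0_less_iff zero_less_Suc)
      moreover have "q * (q ^ j * p k) \<le> q * p (k + j)" using Suc q by (intro mult_left_mono) auto
      ultimately show ?case by (simp add: mult.assoc)
    qed simp
    have "q ^ m * p k \<le> p i" if i: "i \<in> {k..k + m}" for i
    proof -
      have "q ^ m * p k \<le> q ^ (i - k) * p k"
        using i q by (intro mult_right_mono power_decreasing p_pos) auto
      moreover have "i - k \<le> m" using i by auto
      ultimately show ?thesis using step[of "i - k"] i by simp
    qed
    then show ?thesis by (intro exI[of _ "{k..k + m}"]) auto
  qed
  then obtain A where A: "finite A" "card A = Suc m" "\<And>i. i \<in> A \<Longrightarrow> q ^ m * p k \<le> p i" by blast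
  have "1 / 2 * p k \<le> q ^ m * p k" using half by (intro mult_right_mono p_pos) (simp add: q_def)
  then have "(\<Sum>i\<in>A. 1 / 2 * p k) \<le> (\<Sum>i\<in>A. p i)" using A(3) by (intro sum_mono) force
  also have "\<dots> \<le> 1" unfolding p_def by (rule sum_pmf_le_1[OF A(1)])
  finally show ?thesis using A(2) by (simp add: p_def[symmetric] field_simps)
qed

text \<open>First \<open>m\<close> is chosen so that \<open>2 / (m + 1)\<close> is below
  \<open>\<epsilon>\<close>, then \<open>\<mu>\<close> so large that
  \<open>(1 - m / \<mu>) ^ m\<close> exceeds a half.\<close>

lemma poisson_atoms_small:
  assumes "0 < \<epsilon>"
  obtains \<mu> where "0 < \<mu>" "\<And>k. pmf (poisson_pmf \<mu>) k \<le> \<epsilon>"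
proof -
  obtain m :: nat where m: "2 / \<epsilon> < real m" using reals_Archimedean2 by blast
  have "((\<lambda>\<mu>. (1 - real m / \<mu>) ^ m) \<longlongrightarrow> (1 - 0) ^ m) at_top"
    by (intro tendsto_intros tendsto_divide_0[OF tendsto_const] filterlim_at_top_imp_at_infinity filterlim_ident)
  then have "\<forall>\<^sub>F \<mu> in at_top. 1 / 2 < (1 - real m / \<mu>) ^ m"
    by (rule order_tendstoD) simp
  then have "\<forall>\<^sub>F \<mu> in at_top. 1 / 2 < (1 - real m / \<mu>) ^ m \<and> real m < \<mu>"
    using eventually_gt_at_top[of "real m"] by (rule eventually_conj)
  then obtain \<mu> where \<mu>: "1 / 2 < (1 - real m / \<mu>) ^ m" "real m < \<mu>"
    using eventually_happens'[OF trivial_limit_at_top_linorder] by blast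
  have "pmf (poisson_pmf \<mu>) k \<le> \<epsilon>" for k
  proof -
    have "pmf (poisson_pmf \<mu>) k \<le> 2 / (real m + 1)" using \<mu> by (intro poisson_atom_le) auto
    also have "\<dots> \<le> \<epsilon>" using m assms by (simp add: field_simps)
    finally show ?thesis .
  qed
  moreover have "0 < \<mu>" using \<mu>(2) by (meson of_nat_0_le_iff le_less_trans)
  ultimately show ?thesis by (rule that[rotated])
qed

text \<open>Take the least \<open>h\<close> whose lower tail has mass at least a half; strictly
  below it lies at most a half.\<close>

lemma pmf_median:
  fixes p :: "nat pmf"
  obtains h where "1 / 2 \<le> measure_pmf.prob p {..h}" "1 / 2 \<le> measure_pmf.prob p {h..}"
proof -
  have "(\<lambda>n. measure_pmf.prob p {..n}) \<longlonglongrightarrow> measure_pmf.prob p (\<Union>n. {..n})"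
    by (rule measure_pmf.finite_Lim_measure_incseq) (auto simp: incseq_def)
  moreover have "(\<Union>n. {..n}) = (UNIV :: nat set)" by auto
  ultimately have "(\<lambda>n. measure_pmf.prob p {..n}) \<longlonglongrightarrow> 1" by simp
  then have "\<forall>\<^sub>F n in sequentially. 1 / 2 < measure_pmf.prob p {..n}" by (rule order_tendstoD) simp
  then have ex: "\<exists>n. 1 / 2 \<le> measure_pmf.prob p {..n}"
    using eventually_happens'[OF sequentially_bot] less_imp_le by blast
  define h where "h = (LEAST n. 1 / 2 \<le> measure_pmf.prob p {..n})"
  have h: "1 / 2 \<le> measure_pmf.prob p {..h}" unfolding h_def by (rule LeastI_ex[OF ex])
  have "measure_pmf.prob p {..<h} \<le> 1 / 2"
  proof (cases h)
    case (Suc n)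
    then have "\<not> 1 / 2 \<le> measure_pmf.prob p {..n}" unfolding h_def by (metis lessI not_less_Least)
    then show ?thesis by (simp add: Suc lessThan_Suc_atMost)
  qed simp
  moreover have "measure_pmf.prob p {h..} = 1 - measure_pmf.prob p {..<h}"
    using measure_pmf.prob_compl[of "{..<h}" p] by (simp add: Compl_eq_Diff_UNIV[symmetric] Compl_lessThan)
  ultimately show ?thesis using h that by simp
qed

text \<open>If all atoms are at most \<open>1 / (4 * (L + 1))\<close>, the \<open>L\<close> values
  from the median \<open>h\<close> upwards carry at most a quarter, which leaves a quarter beyond
  them.\<close>

lemma poisson_spread:
  obtains \<mu> h where "0 < \<mu>" "1 / 2 \<le> measure_pmf.prob (poisson_pmf \<mu>) {..h}"
    "1 / 4 \<le> measure_pmf.prob (poisson_pmf \<mu>) {h + L..}"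
proof -
  obtain \<mu> where \<mu>: "0 < \<mu>" "\<And>k. pmf (poisson_pmf \<mu>) k \<le> 1 / (4 * (real L + 1))"
    using poisson_atoms_small[of "1 / (4 * (real L + 1))"] by auto
  let ?P = "measure_pmf.prob (poisson_pmf \<mu>)"
  obtain h where h: "1 / 2 \<le> ?P {..h}" "1 / 2 \<le> ?P {h..}" by (rule pmf_median)
  have "{h..} = {h..<h + L} \<union> {h + L..}" by auto
  then have "?P {h..} \<le> ?P {h..<h + L} + ?P {h + L..}"
    using measure_Un_le[of "{h..<h + L}" "measure_pmf (poisson_pmf \<mu>)" "{h + L..}"] by simp
  moreover have "?P {h..<h + L} \<le> (\<Sum>k\<in>{h..<h + L}. 1 / (4 * (real L + 1)))"
    unfolding measure_measure_pmf_finite[OF finite_atLeastLessThan] by (intro sum_mono \<mu>(2))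
  moreover have "(\<Sum>k\<in>{h..<h + L}. 1 / (4 * (real L + 1))) \<le> 1 / 4" by (simp add: field_simps)
  ultimately have "1 / 4 \<le> ?P {h + L..}" using h(2) by linarith
  with \<mu>(1) h(1) show ?thesis by (rule that)
qed

section \<open>Poisson point processes\<close>

lemma space_configuration_space: "space configuration_space = configurations"
  unfolding configuration_space_def by (rule space_measure_of) auto

lemma count_measurable:
  assumes "A \<in> sets borel" "bounded A"
  shows "(\<lambda>X. card (X \<inter> A)) \<in> measurable configuration_space (count_space UNIV)"
  unfolding measurable_count_space_eq2_countable
proof (intro conjI ballI)
  fix k :: nat
  have "{X \<in> configurations. card (X \<inter> A) = k} \<in> sets configuration_space"
    unfolding configuration_space_def using assms by (intro in_measure_of) auto
  moreover have "(\<lambda>X. card (X \<inter> A)) -` {k} \<inter> space configuration_space =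
      {X \<in> configurations. card (X \<inter> A) = k}"
    by (auto simp: space_configuration_space)
  ultimately show "(\<lambda>X. card (X \<inter> A)) -` {k} \<inter> space configuration_space \<in> sets configuration_space"
    by simp
qed auto

lemma count_set_measurable:
  assumes "A \<in> sets borel" "bounded A"
  shows "{X \<in> configurations. card (X \<inter> A) \<in> K} \<in> sets configuration_space"
  using measurable_sets[OF count_measurable[OF assms], of K]
  by (simp add: space_configuration_space vimage_def Int_def conj_commute)

section \<open>Poisson counts, independent events and almost sure properties\<close>

context prob_space
begin

lemma poisson_point_process_measurable:
  "poisson_point_process M \<rho> X \<Longrightarrow> X \<in> measurable M configuration_space"
  by (simp add: poisson_point_process_def)

lemma poisson_point_process_configuration:
  "poisson_point_process M \<rho> X \<Longrightarrow> \<omega> \<in> space M \<Longrightarrow> X \<omega> \<in> configurations"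
  using measurable_space[OF poisson_point_process_measurable] by (simp add: space_configuration_space)

lemma poisson_point_process_count_measurable:
  assumes "poisson_point_process M \<rho> X" "A \<in> sets borel" "bounded A"
  shows "(\<lambda>\<omega>. card (X \<omega> \<inter> A)) \<in> measurable M (count_space UNIV)"
  by (rule measurable_compose[OF poisson_point_process_measurable[OF assms(1)] count_measurable[OF assms(2,3)]])

lemma poisson_point_process_prob:
  assumes X: "poisson_point_process M 1 X" and A: "A \<in> sets borel" "bounded A" "0 < measure lborel A"
  shows "prob {\<omega> \<in> space M. card (X \<omega> \<inter> A) \<in> K} = measure_pmf.prob (poisson_pmf (measure lborel A)) K"
proof -
  let ?N = "\<lambda>\<omega>. card (X \<omega> \<inter> A)" and ?p = "poisson_pmf (measure lborel A)"
  have meas: "?N \<in> measurable M (count_space UNIV)"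
    by (rule poisson_point_process_count_measurable[OF X A(1,2)])
  have "distr M (count_space UNIV) ?N = measure_pmf ?p"
  proof (rule measure_eqI_countable[of _ UNIV])
    fix k :: nat
    have "emeasure (distr M (count_space UNIV) ?N) {k} = prob {\<omega> \<in> space M. ?N \<omega> = k}"
      by (subst emeasure_distr[OF meas]) (auto simp: emeasure_eq_measure vimage_def Int_def conj_commute)
    also have "prob {\<omega> \<in> space M. ?N \<omega> = k} = pmf ?p k"
      using X A unfolding poisson_point_process_def by (simp add: mult.commute)
    finally show "emeasure (distr M (count_space UNIV) ?N) {k} = emeasure (measure_pmf ?p) {k}"
      by (simp add: emeasure_pmf_single)
  qed auto
  then have "measure_pmf.prob ?p K = prob (?N -` K \<inter> space M)"
    using measure_distr[OF meas, of K] by simp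
  then show ?thesis by (simp add: vimage_def Int_def conj_commute)
qed

text \<open>The definition of the process indexes counts by the sets themselves. Nonempty disjoint
  sets make \<open>I\<close> injective, which allows reindexing by natural numbers.\<close>

lemma poisson_point_process_indep_events:
  assumes X: "poisson_point_process M \<rho> X"
    and I: "\<And>j::nat. I j \<in> sets borel" "\<And>j. bounded (I j)" "\<And>j. I j \<noteq> {}" "disjoint_family I"
  shows "indep_events (\<lambda>j. {\<omega> \<in> space M. card (X \<omega> \<inter> I j) \<in> K j}) UNIV"
proof (rule indep_eventsI)
  fix j
  show "{\<omega> \<in> space M. card (X \<omega> \<inter> I j) \<in> K j} \<in> sets M"
    using measurable_sets[OF poisson_point_process_count_measurable[OF X I(1,2)], of "K j" j]
    by (simp add: vimage_def Int_def conj_commute)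
next
  fix J :: "nat set" assume J: "finite J" "J \<noteq> {}"
  have inj: "inj I" and disj: "disjoint (I ` J)"
    using I(3,4) disjoint_family_on_iff_disjoint_image[of UNIV I]
      disjoint_family_on_disjoint_image[OF disjoint_family_on_mono[OF _ I(4)], of J] by auto
  then have inv: "inv I (I j) = j" for j by simp
  have "I ` J \<subseteq> {A \<in> sets borel. bounded A}" "finite (I ` J)" using I(1,2) J(1) by auto
  then have "indep_vars (\<lambda>_. count_space UNIV) (\<lambda>A \<omega>. card (X \<omega> \<inter> A)) (I ` J)"
    using X disj unfolding poisson_point_process_def by blast
  from indep_varsD_finite[OF this, of "\<lambda>A. K (inv I A)"] J
  have "prob (\<Inter>j\<in>J. (\<lambda>\<omega>. card (X \<omega> \<inter> I j)) -` K j \<inter> space M) =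
      (\<Prod>A\<in>I ` J. prob ((\<lambda>\<omega>. card (X \<omega> \<inter> A)) -` K (inv I A) \<inter> space M))"
    by (simp add: inv)
  also have "\<dots> = (\<Prod>j\<in>J. prob ((\<lambda>\<omega>. card (X \<omega> \<inter> I j)) -` K j \<inter> space M))"
    using inj by (subst prod.reindex) (auto simp: inv intro: inj_on_subset)
  finally show "prob (\<Inter>j\<in>J. {\<omega> \<in> space M. card (X \<omega> \<inter> I j) \<in> K j}) =
      (\<Prod>j\<in>J. prob {\<omega> \<in> space M. card (X \<omega> \<inter> I j) \<in> K j})"
    by (simp add: vimage_def Int_def conj_commute)
qed

lemma indep_var_prob:
  assumes "indep_var S X T Y" "C \<in> sets S" "D \<in> sets T"
  shows "prob {\<omega> \<in> space M. X \<omega> \<in> C \<and> Y \<omega> \<in> D} = prob {\<omega> \<in> space M. X \<omega> \<in> C} * prob {\<omega> \<in> space M. Y \<omega> \<in> D}"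
  using indep_varD[OF assms] by (simp add: vimage_def Int_def conj_commute)

text \<open>A finite intersection factorizes first into its \<open>X\<close> part and its
  \<open>Y\<close> part, then each part over the indices.\<close>

lemma indep_events_pair:
  assumes X: "X \<in> measurable M S" and Y: "Y \<in> measurable M T"
    and XY: "\<And>C D. C \<in> sets S \<Longrightarrow> D \<in> sets T \<Longrightarrow>
      prob {\<omega> \<in> space M. X \<omega> \<in> C \<and> Y \<omega> \<in> D} = prob {\<omega> \<in> space M. X \<omega> \<in> C} * prob {\<omega> \<in> space M. Y \<omega> \<in> D}"
    and C: "\<And>j. C j \<in> sets S" "indep_events (\<lambda>j. {\<omega> \<in> space M. X \<omega> \<in> C j}) I"
    and D: "\<And>j. D j \<in> sets T" "indep_events (\<lambda>j. {\<omega> \<in> space M. Y \<omega> \<in> D j}) I"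
  shows "indep_events (\<lambda>j. {\<omega> \<in> space M. X \<omega> \<in> C j \<and> Y \<omega> \<in> D j}) I"
proof (rule indep_eventsI)
  fix j
  show "{\<omega> \<in> space M. X \<omega> \<in> C j \<and> Y \<omega> \<in> D j} \<in> sets M"
    using sets.Int[OF measurable_sets[OF X C(1)[of j]] measurable_sets[OF Y D(1)[of j]]]
    by (rule back_subst) auto
next
  fix J assume J: "J \<subseteq> I" "finite J" "J \<noteq> {}"
  have "prob (\<Inter>j\<in>J. {\<omega> \<in> space M. X \<omega> \<in> C j \<and> Y \<omega> \<in> D j}) =
      prob {\<omega> \<in> space M. X \<omega> \<in> (\<Inter>j\<in>J. C j) \<and> Y \<omega> \<in> (\<Inter>j\<in>J. D j)}"
    using J(3) by (intro arg_cong[where f = prob]) auto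
  also have "\<dots> = prob {\<omega> \<in> space M. X \<omega> \<in> (\<Inter>j\<in>J. C j)} * prob {\<omega> \<in> space M. Y \<omega> \<in> (\<Inter>j\<in>J. D j)}"
    using C(1) D(1) J by (intro XY sets.finite_INT) auto
  also have "{\<omega> \<in> space M. X \<omega> \<in> (\<Inter>j\<in>J. C j)} = (\<Inter>j\<in>J. {\<omega> \<in> space M. X \<omega> \<in> C j})"
    using J(3) by auto
  also have "{\<omega> \<in> space M. Y \<omega> \<in> (\<Inter>j\<in>J. D j)} = (\<Inter>j\<in>J. {\<omega> \<in> space M. Y \<omega> \<in> D j})"
    using J(3) by auto
  also have "prob (\<Inter>j\<in>J. {\<omega> \<in> space M. X \<omega> \<in> C j}) = (\<Prod>j\<in>J. prob {\<omega> \<in> space M. X \<omega> \<in> C j})"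
    using C(2) J unfolding indep_events_def by blast
  also have "prob (\<Inter>j\<in>J. {\<omega> \<in> space M. Y \<omega> \<in> D j}) = (\<Prod>j\<in>J. prob {\<omega> \<in> space M. Y \<omega> \<in> D j})"
    using D(2) J unfolding indep_events_def by blast
  finally show "prob (\<Inter>j\<in>J. {\<omega> \<in> space M. X \<omega> \<in> C j \<and> Y \<omega> \<in> D j}) =
      (\<Prod>j\<in>J. prob {\<omega> \<in> space M. X \<omega> \<in> C j \<and> Y \<omega> \<in> D j})"
    using XY[OF C(1) D(1)] by (simp add: prod.distrib)
qed

text \<open>The limes superior has probability at least \<open>c\<close> by continuity from above,
  and the Borel zero-one law lifts this to 1.\<close>

lemma indep_events_infinitely_often:
  assumes ind: "indep_events (\<lambda>j::nat. {\<omega> \<in> space M. Q j \<omega>}) UNIV"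
    and c: "0 < c" "\<And>j. c \<le> prob {\<omega> \<in> space M. Q j \<omega>}"
  shows "AE \<omega> in M. infinite {j. Q j \<omega>}"
proof -
  define A where "A j = {\<omega> \<in> space M. Q j \<omega>}" for j
  have A: "A j \<in> sets M" for j using ind by (auto simp: indep_events_def A_def)
  let ?B = "\<lambda>n. \<Union>m\<in>{n..}. A m"
  have "(\<lambda>n. prob (?B n)) \<longlonglongrightarrow> prob (\<Inter>n. ?B n)"
  proof (rule finite_Lim_measure_decseq)
    show "range ?B \<subseteq> sets M" using A by auto
    show "decseq ?B" unfolding decseq_def by (intro allI impI UN_mono) auto
  qed
  moreover have "c \<le> prob (?B n)" for n
  proof -
    have "prob (A n) \<le> prob (?B n)" using A by (intro finite_measure_mono) auto
    then show ?thesis using c(2)[of n] by (simp add: A_def)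
  qed
  ultimately have "c \<le> prob (\<Inter>n. ?B n)" by (intro LIMSEQ_le_const) auto
  moreover have "prob (\<Inter>n. ?B n) = 0 \<or> prob (\<Inter>n. ?B n) = 1"
    by (rule borel_0_1_law) (use ind in \<open>simp add: A_def[abs_def]\<close>)
  ultimately have "prob (\<Inter>n. ?B n) = 1" using c(1) by auto
  moreover have "(\<Inter>n. ?B n) \<in> events" using A by auto
  ultimately have "AE \<omega> in M. \<omega> \<in> (\<Inter>n. ?B n)" by (simp only: prob_eq_1)
  then show ?thesis
    by eventually_elim (auto simp: A_def infinite_nat_iff_unbounded_le)
qed

text \<open>The count is a natural number, so the events that it exceeds \<open>L\<close> decrease
  to the empty set.\<close>

lemma count_tight:
  assumes X: "poisson_point_process M \<rho> X" and A: "A \<in> sets borel" "bounded A" and "0 < \<epsilon>"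
  obtains L where "prob {\<omega> \<in> space M. card (X \<omega> \<inter> A) \<in> {L<..}} \<le> \<epsilon>"
proof -
  let ?E = "\<lambda>L. {\<omega> \<in> space M. card (X \<omega> \<inter> A) \<in> {L<..}}"
  have E: "?E L \<in> sets M" for L
    using measurable_sets[OF poisson_point_process_count_measurable[OF X A], of "{L<..}"]
    by (simp add: vimage_def Int_def conj_commute)
  have "(\<lambda>L. prob (?E L)) \<longlonglongrightarrow> prob (\<Inter>L. ?E L)"
    by (rule finite_Lim_measure_decseq) (use E in \<open>auto simp: decseq_def\<close>)
  moreover have "(\<Inter>L. ?E L) = {}" by auto
  ultimately have "(\<lambda>L. prob (?E L)) \<longlonglongrightarrow> 0" by simp
  then have "\<forall>\<^sub>F L in sequentially. prob (?E L) < \<epsilon>" using \<open>0 < \<epsilon>\<close> by (rule order_tendstoD)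
  then show ?thesis using eventually_happens'[OF sequentially_bot] less_imp_le that by blast
qed
text \<open>
  The blocks \<open>U (t\<^sub>j\<^sub>+\<^sub>1) - U (t\<^sub>j)\<close> are chosen so long that, with probability bounded below, the excess of \<open>X\<close>
  over \<open>Y\<close> in the \<open>j\<close>-th block beats by \<open>j\<close> a number that the count of \<open>Y\<close> in \<open>U (t\<^sub>j)\<close> rarely exceeds. The event
  in block \<open>j\<close> compares both counts with a median, so it is a product event and these events are
  independent.
\<close>

lemma poisson_excess_unbounded:
  assumes X: "poisson_point_process M 1 X" and Y: "poisson_point_process M 1 Y"
    and XY: "\<And>C D. C \<in> sets configuration_space \<Longrightarrow> D \<in> sets configuration_space \<Longrightarrow>
      prob {\<omega> \<in> space M. X \<omega> \<in> C \<and> Y \<omega> \<in> D} = prob {\<omega> \<in> space M. X \<omega> \<in> C} * prob {\<omega> \<in> space M. Y \<omega> \<in> D}"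
    and U: "\<And>t::real. U t \<in> sets borel" "\<And>t. bounded (U t)" "\<And>s t. s \<le> t \<Longrightarrow> U s \<subseteq> U t"
      "\<And>s t. 0 \<le> s \<Longrightarrow> s \<le> t \<Longrightarrow> measure lborel (U t - U s) = t - s"
  shows "AE \<omega> in M. \<forall>m. \<exists>t\<ge>0. card (Y \<omega> \<inter> U t) + m \<le> card (X \<omega> \<inter> U t)"
proof -
  \<comment> \<open>Here \<open>t\<close> is the time already reached, \<open>L\<close> bounds the
    count of \<open>Y\<close> so far up to an error summable in \<open>j\<close>, \<open>d\<close>
    is the length of the next block and \<open>h\<close> a median of the count in it.\<close>
  define Q where "Q t j L h d \<longleftrightarrow> 0 < d \<and>
      prob {\<omega> \<in> space M. card (Y \<omega> \<inter> U t) \<in> {L<..}} \<le> (1 / 2) ^ j \<and>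
      1 / 2 \<le> measure_pmf.prob (poisson_pmf d) {..h} \<and>
      1 / 4 \<le> measure_pmf.prob (poisson_pmf d) {h + (L + j)..}" for t d and j L h :: nat
  have "\<exists>L h d. Q t j L h d" for t j
  proof -
    obtain L where L: "prob {\<omega> \<in> space M. card (Y \<omega> \<inter> U t) \<in> {L<..}} \<le> (1 / 2) ^ j"
      using count_tight[OF Y U(1,2), of "(1 / 2) ^ j" t] by auto
    obtain d h where "0 < d" "1 / 2 \<le> measure_pmf.prob (poisson_pmf d) {..h}"
      "1 / 4 \<le> measure_pmf.prob (poisson_pmf d) {h + (L + j)..}"
      by (rule poisson_spread)
    with L have "Q t j L h d" by (simp add: Q_def)
    then show ?thesis by blast
  qed
  then obtain L h d where "\<And>t j. Q t j (L t j) (h t j) (d t j)" by metis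
  then have step: "0 < d t j"
    "prob {\<omega> \<in> space M. card (Y \<omega> \<inter> U t) \<in> {L t j<..}} \<le> (1 / 2) ^ j"
    "1 / 2 \<le> measure_pmf.prob (poisson_pmf (d t j)) {..h t j}"
    "1 / 4 \<le> measure_pmf.prob (poisson_pmf (d t j)) {h t j + (L t j + j)..}" for t j
    by (simp_all add: Q_def)
  \<comment> \<open>Recursive, because the length of a block depends on where the block
    starts.\<close>
  define T where "T = rec_nat 0 (\<lambda>j t. t + d t j)"
  have T: "T 0 = 0" "T (Suc j) = T j + d (T j) j" for j by (simp_all add: T_def)
  have T_mono: "T i \<le> T j" if "i \<le> j" for i j
    by (rule lift_Suc_mono_le[OF _ that]) (simp add: T(2) less_imp_le[OF step(1)])
  have T_nonneg: "0 \<le> T j" for j using T_mono[of 0 j] T(1) by simp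
  define I where "I j = U (T (Suc j)) - U (T j)" for j
  define l where "l j = L (T j) j" for j
  define k where "k j = h (T j) j" for j
  have I_borel: "I j \<in> sets borel" "bounded (I j)" for j
    using U(1,2) by (auto simp: I_def intro: bounded_subset)
  have I_measure: "measure lborel (I j) = d (T j) j" for j
    using U(4)[of "T j" "T (Suc j)"] T_nonneg T_mono[of j "Suc j"] T(2) by (simp add: I_def)
  have I_ne: "I j \<noteq> {}" for j using I_measure[of j] step(1)[of "T j" j] by auto
  have I_disj: "disjoint_family I"
  proof -
    have "I i \<inter> I j = {}" if "i < j" for i j
      using U(3)[OF T_mono[of "Suc i" j]] that by (auto simp: I_def)
    then show ?thesis unfolding disjoint_family_on_def by (metis Int_commute linorder_neqE_nat)
  qed
  define C where "C j = {Z \<in> configurations. card (Z \<inter> I j) \<in> {k j + (l j + j)..}}" for j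
  define D where "D j = {Z \<in> configurations. card (Z \<inter> I j) \<in> {..k j}}" for j
  have CD: "C j \<in> sets configuration_space" "D j \<in> sets configuration_space" for j
    unfolding C_def D_def by (intro count_set_measurable I_borel)+
  have XC: "{\<omega> \<in> space M. X \<omega> \<in> C j} = {\<omega> \<in> space M. card (X \<omega> \<inter> I j) \<in> {k j + (l j + j)..}}" for j
    using poisson_point_process_configuration[OF X] by (auto simp: C_def)
  have YD: "{\<omega> \<in> space M. Y \<omega> \<in> D j} = {\<omega> \<in> space M. card (Y \<omega> \<inter> I j) \<in> {..k j}}" for j
    using poisson_point_process_configuration[OF Y] by (auto simp: D_def)
  have "AE \<omega> in M. infinite {j. X \<omega> \<in> C j \<and> Y \<omega> \<in> D j}"
  \<comment> \<open>The constant is the product of the bounds 1/4 for \<open>X\<close> and 1/2 for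
    \<open>Y\<close>.\<close>
  proof (rule indep_events_infinitely_often[where c = "1 / 8"])
    show "indep_events (\<lambda>j. {\<omega> \<in> space M. X \<omega> \<in> C j \<and> Y \<omega> \<in> D j}) UNIV"
    proof (rule indep_events_pair[OF _ _ XY CD(1) _ CD(2)])
      show "indep_events (\<lambda>j. {\<omega> \<in> space M. X \<omega> \<in> C j}) UNIV"
        unfolding XC by (rule poisson_point_process_indep_events[OF X I_borel I_ne I_disj])
      show "indep_events (\<lambda>j. {\<omega> \<in> space M. Y \<omega> \<in> D j}) UNIV"
        unfolding YD by (rule poisson_point_process_indep_events[OF Y I_borel I_ne I_disj])
    qed (use X Y poisson_point_process_measurable in auto)
    fix j
    have pos: "0 < measure lborel (I j)" using step(1) by (simp add: I_measure)
    have "1 / 4 \<le> prob {\<omega> \<in> space M. X \<omega> \<in> C j}"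
      unfolding XC poisson_point_process_prob[OF X I_borel pos] I_measure k_def l_def by (rule step(4))
    moreover have "1 / 2 \<le> prob {\<omega> \<in> space M. Y \<omega> \<in> D j}"
      unfolding YD poisson_point_process_prob[OF Y I_borel pos] I_measure k_def l_def by (rule step(3))
    ultimately have "1 / 4 * (1 / 2) \<le> prob {\<omega> \<in> space M. X \<omega> \<in> C j} * prob {\<omega> \<in> space M. Y \<omega> \<in> D j}"
      by (intro mult_mono) auto
    then show "1 / 8 \<le> prob {\<omega> \<in> space M. X \<omega> \<in> C j \<and> Y \<omega> \<in> D j}"
      unfolding XY[OF CD] by simp
  qed simp
  \<comment> \<open>By Borel-Cantelli the count of \<open>Y\<close> before block \<open>j\<close> is
    eventually at most \<open>l j\<close>.\<close>
  moreover have "AE \<omega> in M. \<forall>\<^sub>F j in sequentially.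
      \<omega> \<in> space M - {\<omega> \<in> space M. card (Y \<omega> \<inter> U (T j)) \<in> {l j<..}}"
  proof (rule borel_cantelli_AE1)
    show "{\<omega> \<in> space M. card (Y \<omega> \<inter> U (T j)) \<in> {l j<..}} \<in> sets M" for j
      using measurable_sets[OF poisson_point_process_count_measurable[OF Y U(1,2)], of "{l j<..}" "T j"]
      by (simp add: vimage_def Int_def conj_commute)
    show "summable (\<lambda>j. prob {\<omega> \<in> space M. card (Y \<omega> \<inter> U (T j)) \<in> {l j<..}})"
      by (rule summable_comparison_test'[OF summable_geometric[of "1 / 2 :: real"], of 0])
        (use step(2) in \<open>simp_all add: l_def\<close>)
  qed (simp add: emeasure_eq_measure)
  ultimately show ?thesis
    using AE_space
  proof eventually_elim
    case (elim \<omega>)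
    show ?case
    proof
      fix m
      obtain J where J: "\<And>j. J \<le> j \<Longrightarrow> card (Y \<omega> \<inter> U (T j)) \<le> l j"
        using elim(2,3) by (auto simp: eventually_sequentially not_less)
      \<comment> \<open>From \<open>J\<close> on, the earlier count of \<open>Y\<close> is at most
        \<open>l j\<close>; \<open>j \<ge> m\<close> makes the surplus \<open>j\<close> of the block
        large enough.\<close>
      obtain j where j: "max J m \<le> j" "X \<omega> \<in> C j" "Y \<omega> \<in> D j"
        using elim(1) unfolding infinite_nat_iff_unbounded_le by blast
      have fin: "finite (X \<omega> \<inter> U t)" for t
        using poisson_point_process_configuration[OF X elim(3)] U(2) by (auto simp: configurations_def)
      have "Y \<omega> \<inter> U (T (Suc j)) = (Y \<omega> \<inter> U (T j)) \<union> (Y \<omega> \<inter> I j)"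
        using U(3)[OF T_mono[of j "Suc j"]] by (auto simp: I_def)
      then have "card (Y \<omega> \<inter> U (T (Suc j))) \<le> card (Y \<omega> \<inter> U (T j)) + card (Y \<omega> \<inter> I j)"
        using card_Un_le by metis
      also have "\<dots> \<le> l j + k j" using J[of j] j by (intro add_mono) (auto simp: D_def)
      finally have "card (Y \<omega> \<inter> U (T (Suc j))) + m \<le> k j + (l j + j)" using j(1) by simp
      also have "\<dots> \<le> card (X \<omega> \<inter> I j)" using j(2) by (simp add: C_def)
      also have "\<dots> \<le> card (X \<omega> \<inter> U (T (Suc j)))"
        by (intro card_mono fin) (auto simp: I_def)
      finally show "\<exists>t\<ge>0. card (Y \<omega> \<inter> U t) + m \<le> card (X \<omega> \<inter> U t)"
        using T_nonneg by blast
    qed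
  qed
qed

text \<open>
  Union bound over the \<open>2 n (m + 1)\<close> cells of length \<open>1 / (m + 1)\<close> in \<open>{-n..<n}\<close>: a cell contains points of
  both processes with probability at most \<open>1 / (m + 1)\<^sup>2\<close>.
\<close>

lemma poisson_point_processes_disjoint:
  assumes X: "poisson_point_process M 1 X" and Y: "poisson_point_process M 1 Y"
    and XY: "\<And>C D. C \<in> sets configuration_space \<Longrightarrow> D \<in> sets configuration_space \<Longrightarrow>
      prob {\<omega> \<in> space M. X \<omega> \<in> C \<and> Y \<omega> \<in> D} = prob {\<omega> \<in> space M. X \<omega> \<in> C} * prob {\<omega> \<in> space M. Y \<omega> \<in> D}"
  shows "AE \<omega> in M. X \<omega> \<inter> Y \<omega> = {}"
proof -
  \<comment> \<open>Half-open cells tile the line, so at each scale \<open>m\<close> a common point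
    falls into exactly one of them.\<close>
  define cell where "cell m i = {real_of_int i / real (Suc m)..<real_of_int (i + 1) / real (Suc m)}" for m i
  define G where "G A = {Z \<in> configurations. card (Z \<inter> A) \<in> {0<..}}" for A :: "real set"
  have cell: "cell m i \<in> sets borel" "bounded (cell m i)" for m i
    by (auto simp: cell_def)
  have len: "measure lborel (cell m i) = 1 / real (Suc m)" for m i
    by (simp add: cell_def divide_right_mono diff_divide_distrib[symmetric])
  have G: "G (cell m i) \<in> sets configuration_space" for m i
    unfolding G_def by (intro count_set_measurable cell)
  have G_prob: "prob {\<omega> \<in> space M. Z \<omega> \<in> G (cell m i)} \<le> 1 / real (Suc m)"
    if Z: "poisson_point_process M 1 Z" for Z m i
  proof -
    define r where "r = 1 / real (Suc m)"
    have r: "0 < r" by (simp add: r_def)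
    have "{\<omega> \<in> space M. Z \<omega> \<in> G (cell m i)} = {\<omega> \<in> space M. card (Z \<omega> \<inter> cell m i) \<in> {0<..}}"
      using poisson_point_process_configuration[OF Z] by (auto simp: G_def)
    then have "prob {\<omega> \<in> space M. Z \<omega> \<in> G (cell m i)} = measure_pmf.prob (poisson_pmf r) {0<..}"
      using poisson_point_process_prob[OF Z cell, of m i "{0<..}"] r by (simp only: len r_def)
    also have "{0<..} = UNIV - {0::nat}" by auto
    also have "measure_pmf.prob (poisson_pmf r) (UNIV - {0}) = 1 - exp (- r)"
      using measure_pmf.prob_compl[of "{0}" "poisson_pmf r"] r by (simp add: measure_pmf_single)
    also have "\<dots> \<le> r" using exp_ge_add_one_self[of "- r"] by simp
    finally show ?thesis by (simp add: r_def)
  qed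
  have "AE \<omega> in M. X \<omega> \<inter> Y \<omega> \<inter> {- real n..<real n} = {}" for n
  proof -
    define A where "A m i = {\<omega> \<in> space M. X \<omega> \<in> G (cell m i) \<and> Y \<omega> \<in> G (cell m i)}" for m i
    define K where "K m = {- int (n * Suc m)..<int (n * Suc m)}" for m
    have A: "A m i \<in> sets M" for m i
      using sets.Int[OF measurable_sets[OF poisson_point_process_measurable[OF X] G]
          measurable_sets[OF poisson_point_process_measurable[OF Y] G]]
      unfolding A_def by (rule back_subst) auto
    have A_prob: "prob (A m i) \<le> 1 / real (Suc m) * (1 / real (Suc m))" for m i
      unfolding A_def XY[OF G G] by (intro mult_mono G_prob X Y) auto
    have E: "(\<Union>i\<in>K m. A m i) \<in> sets M" for m using A by (auto simp: K_def)
    have cancel: "2 * a * b * (1 / b * (1 / b)) = 2 * a * (1 / b)" if "b \<noteq> 0" for a b :: real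
      using that by simp
    have card_K: "real (card (K m)) = 2 * real n * real (Suc m)" for m
      by (simp add: K_def algebra_simps)
    have bound: "prob (\<Union>i\<in>K m. A m i) \<le> 2 * real n * (1 / real (Suc m))" for m
    proof -
      have "prob (\<Union>i\<in>K m. A m i) \<le> (\<Sum>i\<in>K m. prob (A m i))"
        using A by (intro finite_measure_subadditive_finite) (auto simp: K_def)
      also have "\<dots> \<le> (\<Sum>i\<in>K m. 1 / real (Suc m) * (1 / real (Suc m)))"
        by (intro sum_mono A_prob)
      also have "\<dots> = 2 * real n * real (Suc m) * (1 / real (Suc m) * (1 / real (Suc m)))"
        by (simp only: sum_constant card_K)
      also have "\<dots> = 2 * real n * (1 / real (Suc m))"
        by (rule cancel) simp
      finally show ?thesis .
    qed
    have cover: "\<omega> \<in> (\<Union>i\<in>K m. A m i)"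
      if \<omega>: "\<omega> \<in> space M" and x: "x \<in> X \<omega>" "x \<in> Y \<omega>" "x \<in> {- real n..<real n}" for \<omega> x m
    proof -
      define i where "i = \<lfloor>x * real (Suc m)\<rfloor>"
      have i: "real_of_int i \<le> x * real (Suc m)" "x * real (Suc m) < real_of_int i + 1"
        by (simp_all add: i_def)
      then have xc: "x \<in> cell m i"
        by (simp add: cell_def divide_le_eq less_divide_eq del: of_nat_Suc)
      have "- real n * real (Suc m) \<le> x * real (Suc m)" "x * real (Suc m) < real n * real (Suc m)"
        using x(3) by (intro mult_right_mono mult_strict_right_mono; simp)+
      then have "i \<in> K m"
        unfolding K_def i_def atLeastLessThan_iff le_floor_iff floor_less_iff
        by (simp only: of_int_minus of_int_of_nat_eq of_nat_mult of_int_mult mult_minus_left simp_thms)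
      moreover have "Z \<omega> \<in> G (cell m i)"
        if "poisson_point_process M 1 Z" "x \<in> Z \<omega>" for Z
      proof -
        have "Z \<omega> \<in> configurations" by (rule poisson_point_process_configuration[OF that(1) \<omega>])
        moreover from this have "finite (Z \<omega> \<inter> cell m i)" using cell(2) by (auto simp: configurations_def)
        then have "0 < card (Z \<omega> \<inter> cell m i)" using that(2) xc by (auto simp: card_gt_0_iff)
        ultimately show ?thesis by (simp add: G_def)
      qed
      ultimately show ?thesis using \<omega> x X Y by (auto simp: A_def)
    qed
    \<comment> \<open>A common point in \<open>{- real n..<real n}\<close> puts
      \<open>\<omega>\<close> into this measurable set, whose probability lies below every term of a
      null sequence.\<close>
    have "prob (\<Inter>m. \<Union>i\<in>K m. A m i) \<le> 0"
    proof (rule LIMSEQ_le_const)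
      show "(\<lambda>m. 2 * real n * (1 / real (Suc m))) \<longlonglongrightarrow> 0"
        using tendsto_mult[OF tendsto_const LIMSEQ_Suc[OF lim_1_over_n], of "2 * real n"] by simp
      have "prob (\<Inter>m. \<Union>i\<in>K m. A m i) \<le> 2 * real n * (1 / real (Suc m))" for m
      proof -
        have "prob (\<Inter>m. \<Union>i\<in>K m. A m i) \<le> prob (\<Union>i\<in>K m. A m i)"
          using E by (intro finite_measure_mono) auto
        then show ?thesis using bound by (rule order.trans)
      qed
      then show "\<exists>N. \<forall>m\<ge>N. prob (\<Inter>m. \<Union>i\<in>K m. A m i) \<le> 2 * real n * (1 / real (Suc m))" by blast
    qed
    then have "prob (\<Inter>m. \<Union>i\<in>K m. A m i) = 0" by (simp add: measure_le_0_iff)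
    moreover have "(\<Inter>m. \<Union>i\<in>K m. A m i) \<in> sets M" using E by auto
    ultimately have "AE \<omega> in M. \<omega> \<notin> (\<Inter>m. \<Union>i\<in>K m. A m i)" by (simp only: prob_eq_0)
    then show ?thesis
      using AE_space
    proof eventually_elim
      case (elim \<omega>)
      show ?case
      proof (rule equals0I)
        fix x assume "x \<in> X \<omega> \<inter> Y \<omega> \<inter> {- real n..<real n}"
        then have "\<omega> \<in> (\<Union>i\<in>K m. A m i)" for m using cover[OF elim(2), of x] by auto
        then show False using elim(1) by blast
      qed
    qed
  qed
  then have "AE \<omega> in M. \<forall>n. X \<omega> \<inter> Y \<omega> \<inter> {- real n..<real n} = {}" by (simp add: AE_all_countable)
  then show ?thesis
  proof eventually_elim
    case (elim \<omega>)
    show ?case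
    proof (rule equals0I)
      fix x assume x: "x \<in> X \<omega> \<inter> Y \<omega>"
      obtain n where "\<bar>x\<bar> < real n" using reals_Archimedean2 by blast
      then have "x \<in> X \<omega> \<inter> Y \<omega> \<inter> {- real n..<real n}" using x by auto
      with elim show False by blast
    qed
  qed
qed

text \<open>To the right the walk descends where \<open>Y\<close> outnumbers \<open>X\<close> on
  \<open>{0<..t}\<close>. At \<open>- t\<close> it is minus the excess over \<open>{-t<..0}\<close>,
  so to the left it descends where \<open>X\<close> outnumbers \<open>Y\<close>.\<close>

lemma poisson_descending:
  assumes X: "poisson_point_process M 1 X" and Y: "poisson_point_process M 1 Y"
    and XY: "\<And>C D. C \<in> sets configuration_space \<Longrightarrow> D \<in> sets configuration_space \<Longrightarrow>
      prob {\<omega> \<in> space M. X \<omega> \<in> C \<and> Y \<omega> \<in> D} = prob {\<omega> \<in> space M. X \<omega> \<in> C} * prob {\<omega> \<in> space M. Y \<omega> \<in> D}"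
  shows "AE \<omega> in M. descending (X \<omega>) (Y \<omega>)"
proof -
  have YX: "prob {\<omega> \<in> space M. Y \<omega> \<in> C \<and> X \<omega> \<in> D} = prob {\<omega> \<in> space M. Y \<omega> \<in> C} * prob {\<omega> \<in> space M. X \<omega> \<in> D}"
    if "C \<in> sets configuration_space" "D \<in> sets configuration_space" for C D
    using XY[OF that(2,1)] by (simp add: conj_commute mult.commute)
  have "{0<..t} - {0<..s} = {s<..t}" "{-t<..0} - {-s<..0} = {-t<..-s}" if "0 \<le> s" "s \<le> t" for s t :: real
    using that by auto
  then have len: "measure lborel ({0<..t} - {0<..s}) = t - s" "measure lborel ({-t<..0} - {-s<..0}) = t - s"
    if "0 \<le> s" "s \<le> t" for s t :: real
    using that by simp_all
  have "AE \<omega> in M. \<forall>m. \<exists>t\<ge>0. card (X \<omega> \<inter> {0<..t}) + m \<le> card (Y \<omega> \<inter> {0<..t})"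
    by (rule poisson_excess_unbounded[OF Y X YX]) (use len(1) in auto)
  moreover have "AE \<omega> in M. \<forall>m. \<exists>t\<ge>0. card (Y \<omega> \<inter> {-t<..0}) + m \<le> card (X \<omega> \<inter> {-t<..0})"
    by (rule poisson_excess_unbounded[OF X Y XY]) (use len(2) in auto)
  moreover have "AE \<omega> in M. X \<omega> \<inter> Y \<omega> = {}"
    by (rule poisson_point_processes_disjoint[OF X Y XY])
  ultimately show ?thesis
    using AE_space
  proof eventually_elim
    case (elim \<omega>)
    show ?case
    proof
      show "X \<omega> \<in> configurations" "Y \<omega> \<in> configurations"
        using poisson_point_process_configuration[OF _ elim(4)] X Y by auto
      show "X \<omega> \<inter> Y \<omega> = {}" by (rule elim(3))
      fix m :: int
      \<comment> \<open>The surplus \<open>nat (- m) + 1\<close> gives a strict inequality for every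
        integer \<open>m\<close>, positive ones included.\<close>
      obtain t where t: "0 \<le> t" "card (X \<omega> \<inter> {0<..t}) + (nat (- m) + 1) \<le> card (Y \<omega> \<inter> {0<..t})"
        using elim(1) by blast
      have "walk (X \<omega>) (Y \<omega>) t < m"
        using t unfolding walk_def excess_def by simp
      with t(1) show "\<exists>t\<ge>0. walk (X \<omega>) (Y \<omega>) t < m" by blast
      obtain t where t: "0 \<le> t" "card (Y \<omega> \<inter> {-t<..0}) + (nat (- m) + 1) \<le> card (X \<omega> \<inter> {-t<..0})"
        using elim(2) by blast
      have "walk (X \<omega>) (Y \<omega>) (- t) < m"
      proof -
        \<comment> \<open>At \<open>t = 0\<close> the other branch of \<open>walk\<close> applies,
          and all counts are 0.\<close>
        have "walk (X \<omega>) (Y \<omega>) (- t) = int (card (Y \<omega> \<inter> {-t<..0})) - int (card (X \<omega> \<inter> {-t<..0}))"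
          using t(1) by (cases "t = 0") (auto simp: walk_def excess_def)
        then show ?thesis using t(2) by linarith
      qed
      with t(1) show "\<exists>t\<le>0. walk (X \<omega>) (Y \<omega>) t < m" by (intro exI[of _ "- t"]) simp
    qed
  qed
qed

end

theorem theorem1p3:
  fixes P :: "'w measure" and R B :: "'w \<Rightarrow> real set"
  assumes "prob_space P"
    and "poisson_point_process P 1 R"
    and "poisson_point_process P 1 B"
    and "prob_space.indep_var P configuration_space R configuration_space B"
  shows "AE \<omega> in P.
    (\<forall>\<gamma><0. uncountable {M. minimal_matching \<gamma> (R \<omega>) (B \<omega>) M}) \<and>
    ((\<forall>\<gamma>\<in>{0..<1}. \<exists>!M. minimal_matching \<gamma> (R \<omega>) (B \<omega>) M) \<and>
     (\<exists>!M. minimal_matching_1minus (R \<omega>) (B \<omega>) M)) \<and>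
    uncountable {M. minimal_matching 1 (R \<omega>) (B \<omega>) M} \<and>
    ((\<nexists>M. minimal_matching_1plus (R \<omega>) (B \<omega>) M) \<and>
     (\<forall>\<gamma>>1. \<nexists>M. minimal_matching \<gamma> (R \<omega>) (B \<omega>) M))"
proof -
  interpret prob_space P by fact
  note RB = indep_var_prob[OF assms(4)]
  have BR: "prob {\<omega> \<in> space P. B \<omega> \<in> C \<and> R \<omega> \<in> D} = prob {\<omega> \<in> space P. B \<omega> \<in> C} * prob {\<omega> \<in> space P. R \<omega> \<in> D}"
    if "C \<in> sets configuration_space" "D \<in> sets configuration_space" for C D
    using RB[OF that(2,1)] by (simp add: conj_commute mult.commute)
  have "AE \<omega> in P. descending (R \<omega>) (B \<omega>)" by (rule poisson_descending[OF assms(2,3) RB])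
  \<comment> \<open>With the colours exchanged: the original walk is also unbounded above in both
    directions.\<close>
  moreover have "AE \<omega> in P. descending (B \<omega>) (R \<omega>)" by (rule poisson_descending[OF assms(3,2) BR])
  ultimately show ?thesis
  proof eventually_elim
    case (elim \<omega>)
    show ?case by (rule minimal_matchings_description[OF elim])
  qed
qed

end
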